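(* Let $(\xi,\mu,\eta)$ be a linear representation over $\Sigma=\{a_1,\dots,a_\ell,b\}$ satisfying the standing assumptions in the context, such that the matrix $M=A_1+\cdots+A_\ell+B$ is primitive, and let $\mathbf{Y}_n$ be the associated $\mathbb{R}^\ell$-valued symbol statistics. Let $y(\mathbf{t})$ be the Perron-Frobenius eigenvalue of $M(\mathbf{t})=A_1e^{t_1}+\cdots+A_\ell e^{t_\ell}+B$, and set $\boldsymbol{\beta}=\frac{\nabla y(\mathbf{0})}{y(\mathbf{0})}$ and $\Gamma=H\log y(\mathbf{0})$, the Hessian matrix of $\log y$ at $\mathbf{0}$. Then, for every sequence of positive reals $\{a_n\}$ such that $a_n\to 0$ and $na_n\to\infty$, the sequence $$\frac{\mathbf{Y}_n-n\boldsymbol{\beta}}{\sqrt{n/a_n}}$$ satisfies a Large Deviation Principle with speed $1/a_n$ and rate function $$J^*(\mathbf{x})=\sup_{\mathbf{t}\in\mathbb{R}^\ell}\Big\{\mathbf{t}\cdot\mathbf{x}-\tfrac12\,\mathbf{t}'\Gamma\mathbf{t}\Big\},\qquad \mathbf{x}\in\mathbb{R}^\ell.$$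
   Context: Model. Let $\ell\ge 1$, $m\ge 1$ be integers, $\Sigma=\{a_1,\dots,a_\ell,b\}$ a finite alphabet with $\ell+1$ symbols, $\mathbb{R}_+=[0,\infty)$. Fix column vectors $\xi,\eta\in\mathbb{R}_+^m$ and matrices $A_1,\dots,A_\ell,B\in\mathbb{R}_+^{m\times m}$. Let $\mu$ be the monoid morphism from the set $\Sigma^*$ of all words over $\Sigma$ to $\mathbb{R}_+^{m\times m}$ with $\mu(a_i)=A_i$, $\mu(b)=B$. The triple $(\xi,\mu,\eta)$ is called a linear representation. A prime denotes transposition. Put $M=A_1+\cdots+A_\ell+B$. Standing assumptions: all of $A_1,\dots,A_\ell,B$ are nonzero matrices, and for every sufficiently large $n$ there is a word $w$ of length $n$ with $\xi'\mu(w)\eta>0$ (so $\xi\ne 0\ne\eta$ and $\xi'M^n\eta>0$ for all large $n$). For such $n$, the set $\Sigma^n$ of words of length $n$ carries the probability measure $\Pr(w)=\dfrac{\xi'\mu(w)\eta}{\xi'M^n\eta}$, and $\mathbf{Y}_n=(|w|_{a_1},\dots,|w|_{a_\ell})$, where $w$ is random in $\Sigma^n$ with law $\Pr$ and $|w|_{x}$ is the number of occurrences of $x$ in $w$. Sequences indexed by $n$ are considered for $n$ large enough that $\mathbf{Y}_n$ is defined. A matrix $T\in\mathbb{R}_+^{m\times m}$ is primitive if $T^k$ has all entries strictly positive for some $k\ge 1$; its Perron-Frobenius eigenvalue is its unique eigenvalue of largest modulus, which is real, positive and simple. If $M$ is primitive then $M(\mathbf{t})$ is primitive for all $\mathbf{t}\in\mathbb{R}^\ell$;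 $y(\mathbf{t})$ is a positive function, analytic on $\mathbb{R}^\ell$. Large deviations. A rate function is a lower semicontinuous map $I:\mathbb{R}^\ell\to[0,\infty]$. Given positive reals $v_n\to\infty$, a sequence of $\mathbb{R}^\ell$-valued random variables $\{\mathbf{X}_n\}$ satisfies the Large Deviation Principle with speed $v_n$ and rate function $I$ if $\liminf_{n\to\infty}\frac1{v_n}\log P(\mathbf{X}_n\in O)\ge-\inf_{\mathbf{x}\in O}I(\mathbf{x})$ for all open $O\subseteq\mathbb{R}^\ell$ and $\limsup_{n\to\infty}\frac1{v_n}\log P(\mathbf{X}_n\in C)\le-\inf_{\mathbf{x}\in C}I(\mathbf{x})$ for all closed $C\subseteq\mathbb{R}^\ell$. *)

theory Defs
  imports "HOL-Probability.Probability"
begin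

section \<open>Linear representations and symbol statistics\<close>

text \<open>
  The alphabet is the type \<open>'l option\<close>: \<open>Some i\<close> is the symbol a_i and \<open>None\<close> is the symbol b.
  The index type \<open>'l\<close> has \<open>\<ell>\<close> elements and \<open>'m\<close> has m elements, both nonempty as types.
\<close>

primrec mu :: "('l \<Rightarrow> real^'m^'m) \<Rightarrow> real^'m^'m \<Rightarrow> 'l option list \<Rightarrow> real^'m^'m" where
  "mu A B [] = mat 1"
| "mu A B (x # w) = (case x of Some i \<Rightarrow> A i | None \<Rightarrow> B) ** mu A B w"

text \<open>The multiplication of type class \<open>times\<close> on \<open>real^'m^'m\<close> is componentwise, so powers are
  iterated from the matrix product.\<close>

definition mat_pow :: "real^'m^'m \<Rightarrow> nat \<Rightarrow> real^'m^'m" where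
  "mat_pow T k = (((**) T) ^^ k) (mat 1)"

definition total_matrix :: "('l::finite \<Rightarrow> real^'m^'m) \<Rightarrow> real^'m^'m \<Rightarrow> real^'m^'m" where
  "total_matrix A B = (\<Sum>i\<in>UNIV. A i) + B"

definition tilted_matrix ::
    "('l::finite \<Rightarrow> real^'m^'m) \<Rightarrow> real^'m^'m \<Rightarrow> real^'l \<Rightarrow> real^'m^'m" where
  "tilted_matrix A B t = (\<Sum>i\<in>UNIV. exp (t $ i) *\<^sub>R A i) + B"

definition word_weight ::
    "real^'m \<Rightarrow> ('l \<Rightarrow> real^'m^'m) \<Rightarrow> real^'m^'m \<Rightarrow> real^'m \<Rightarrow> 'l option list \<Rightarrow> real" where
  "word_weight \<xi> A B \<eta> w = \<xi> \<bullet> (mu A B w *v \<eta>)"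

definition linear_representation ::
    "real^'m \<Rightarrow> ('l::finite \<Rightarrow> real^'m^'m) \<Rightarrow> real^'m^'m \<Rightarrow> real^'m \<Rightarrow> bool" where
  "linear_representation \<xi> A B \<eta> \<longleftrightarrow>
     (\<forall>j. 0 \<le> \<xi> $ j) \<and> (\<forall>j. 0 \<le> \<eta> $ j) \<and>
     (\<forall>i j k. 0 \<le> A i $ j $ k) \<and> (\<forall>j k. 0 \<le> B $ j $ k) \<and>
     (\<forall>i. A i \<noteq> 0) \<and> B \<noteq> 0 \<and>
     (\<forall>\<^sub>F n in sequentially. \<exists>w. length w = n \<and> 0 < word_weight \<xi> A B \<eta> w)"

text \<open>For the finitely many \<open>n\<close> where the normalising constant vanishes, this is the zero measure
  (division by zero yields zero).\<close>

definition word_measure ::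
    "real^'m \<Rightarrow> ('l::finite \<Rightarrow> real^'m^'m) \<Rightarrow> real^'m^'m \<Rightarrow> real^'m \<Rightarrow> nat
      \<Rightarrow> 'l option list measure" where
  "word_measure \<xi> A B \<eta> n =
     point_measure {w. length w = n}
       (\<lambda>w. ennreal (word_weight \<xi> A B \<eta> w / (\<xi> \<bullet> (mat_pow (total_matrix A B) n *v \<eta>))))"

definition symbol_statistics :: "'l option list \<Rightarrow> real^'l" where
  "symbol_statistics w = (\<chi> i. real (count_list w (Some i)))"


section \<open>Primitive matrices and the Perron-Frobenius eigenvalue\<close>

definition primitive_matrix :: "real^'m^'m \<Rightarrow> bool" where
  "primitive_matrix T \<longleftrightarrow>
     (\<forall>i j. 0 \<le> T $ i $ j) \<and> (\<exists>k\<ge>1. \<forall>i j. 0 < mat_pow T k $ i $ j)"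

definition complex_eigenvalue :: "real^'m^'m \<Rightarrow> complex \<Rightarrow> bool" where
  "complex_eigenvalue T z \<longleftrightarrow>
     (\<exists>v::complex^'m. v \<noteq> 0 \<and> (\<chi> i j. complex_of_real (T $ i $ j)) *v v = z *s v)"

definition pf_eigenvalue :: "real^'m^'m \<Rightarrow> real" where
  "pf_eigenvalue T =
     Re (THE z. complex_eigenvalue T z \<and>
                (\<forall>w. complex_eigenvalue T w \<and> w \<noteq> z \<longrightarrow> cmod w < cmod z))"


section \<open>Gradient and Hessian\<close>

definition gradient :: "('a::real_inner \<Rightarrow> real) \<Rightarrow> 'a \<Rightarrow> 'a" where
  "gradient f x = (THE D. GDERIV f x :> D)"

definition hessian :: "(real^'l \<Rightarrow> real) \<Rightarrow> real^'l \<Rightarrow> real^'l^'l" where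
  "hessian f x = jacobian (gradient f) (at x)"


section \<open>Large deviations\<close>

definition rate_function :: "('a::topological_space \<Rightarrow> ereal) \<Rightarrow> bool" where
  "rate_function I \<longleftrightarrow> (\<forall>x. 0 \<le> I x) \<and> (\<forall>c. closed {x. I x \<le> c})"

text \<open>The real logarithm has \<open>ln 0 = 0\<close>; here the logarithm of a null probability is \<open>-\<infinity>\<close>.\<close>

definition log_prob :: "real \<Rightarrow> ereal" where
  "log_prob p = (if p = 0 then -\<infinity> else ereal (ln p))"

text \<open>The random variables may live on different spaces, and they need to be defined only for
  large \<open>n\<close>.\<close>

definition satisfies_LDP ::
    "(nat \<Rightarrow> 'w measure) \<Rightarrow> (nat \<Rightarrow> 'w \<Rightarrow> 'a::topological_space) \<Rightarrow> (nat \<Rightarrow> real)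
      \<Rightarrow> ('a \<Rightarrow> ereal) \<Rightarrow> bool" where
  "satisfies_LDP P X v I \<longleftrightarrow>
     (\<forall>\<^sub>F n in sequentially. prob_space (P n) \<and> X n \<in> borel_measurable (P n)) \<and>
     (\<forall>n. 0 < v n) \<and> filterlim v at_top sequentially \<and>
     rate_function I \<and>
     (\<forall>U. open U \<longrightarrow>
        - (INF x\<in>U. I x) \<le>
        liminf (\<lambda>n. ereal (1 / v n) * log_prob (measure (P n) {\<omega> \<in> space (P n). X n \<omega> \<in> U}))) \<and>
     (\<forall>C. closed C \<longrightarrow>
        limsup (\<lambda>n. ereal (1 / v n) * log_prob (measure (P n) {\<omega> \<in> space (P n). X n \<omega> \<in> C}))
        \<le> - (INF x\<in>C. I x))"

end

theory Submission
  imports Defs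
begin

text \<open>
  Write \<open>M t\<close> for the tilted matrix. The normalised symbol statistics have scaled cumulant generating
  function \<open>a n * (ln (W n (r *\<^sub>R t)) - ln (W n 0) - n * r * (t \<bullet> \<beta>))\<close>, where
  \<open>W n t = \<xi> \<bullet> ((M t)^n *v \<eta>)\<close> and \<open>r = 1 / sqrt (n * a n)\<close> tends to 0. Since \<open>M 0\<close> is primitive,
  \<open>W n t\<close> equals \<open>y t ^ n\<close> up to factors bounded near \<open>t = 0\<close>, which \<open>a n \<rightarrow> 0\<close> kills, and
  \<open>a n * n = 1 / r^2\<close>, so the second-order expansion of \<open>ln y\<close> at 0 gives the limit \<open>(t \<bullet> \<Gamma> *v t) / 2\<close>.
  The Perron eigenvalue is differentiated through the identity
  \<open>(y t - y s) * (u s \<bullet> v t) = u s \<bullet> ((M t - M s) *v v t)\<close> for left and right eigenvectors \<open>u, v\<close>,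
  which together with the differentiability of \<open>u\<close> and \<open>v\<close> makes the gradient of \<open>y\<close> differentiable.

  For a quadratic limit of cumulants the Gaertner-Ellis theorem is elementary: Chernoff bounds on
  finitely many half-spaces give the upper bound. For the lower bound, a point \<open>S t\<close> in the range of
  the symmetrised Hessian \<open>S\<close> is where the exponential tilt by \<open>t\<close> concentrates the measure, and
  outside the range the rate is infinite.
\<close>

section \<open>Large deviations from quadratic scaled cumulants\<close>

lemma ereal_le_uminus_iff:
  fixes a b :: ereal
  shows "a \<le> - b \<longleftrightarrow> b \<le> - a"
  by (cases rule: ereal2_cases[of a b]) auto

lemma limsup_log_prob_le:
  assumes v: "\<And>n. 0 < v n" and p: "\<And>n. 0 \<le> p n"
    and le: "\<forall>\<^sub>F n in sequentially. p n \<le> exp (- (v n * \<alpha>))"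
  shows "limsup (\<lambda>n. ereal (1 / v n) * log_prob (p n)) \<le> ereal (- \<alpha>)"
proof (rule Limsup_bounded)
  show "\<forall>\<^sub>F n in sequentially. ereal (1 / v n) * log_prob (p n) \<le> ereal (- \<alpha>)"
    using le
  proof eventually_elim
    case (elim n)
    show ?case
    proof (cases "p n = 0")
      case True
      \<comment> \<open>Here \<open>log_prob\<close> is \<open>-\<infinity>\<close>, and the
        positive factor \<open>1 / v n\<close> keeps it there.\<close>
      then show ?thesis using v[of n] by (simp add: log_prob_def)
    next
      case False
      then have "p n > 0" using p[of n] by simp
      then have "ln (p n) \<le> - (v n * \<alpha>)" using elim ln_mono[of "p n" "exp (- (v n * \<alpha>))"] by simp
      then show ?thesis using v[of n] False
        by (simp add: log_prob_def field_simps)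
    qed
  qed
qed

lemma liminf_log_prob_ge:
  assumes v: "\<And>n. 0 < v n"
    and ge: "\<forall>\<^sub>F n in sequentially. exp (- (v n * \<alpha>)) \<le> p n"
  shows "ereal (- \<alpha>) \<le> liminf (\<lambda>n. ereal (1 / v n) * log_prob (p n))"
proof (rule Liminf_bounded)
  show "\<forall>\<^sub>F n in sequentially. ereal (- \<alpha>) \<le> ereal (1 / v n) * log_prob (p n)"
    using ge
  proof eventually_elim
    case (elim n)
    have "p n > 0" using elim exp_gt_zero[of "- (v n * \<alpha>)"] by linarith
    then have "ln (p n) \<ge> - (v n * \<alpha>)" using elim by (simp add: ln_ge_iff)
    then show ?case using v[of n] \<open>p n > 0\<close>
      by (simp add: log_prob_def field_simps)
  qed
qed

text \<open>Markov's inequality for the measure with density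
  \<open>exp (r * (t \<bullet> X w))\<close>: on the half-space the factor
  \<open>exp (r * (s \<bullet> X w - c))\<close> is at least 1. With \<open>t = 0\<close> it is the
  usual Chernoff bound; general \<open>t\<close> serves the change of measure in the lower
  bound.\<close>

lemma tilted_chernoff:
  fixes X :: "'w \<Rightarrow> 'a::euclidean_space"
  assumes X[measurable]: "X \<in> borel_measurable M" and r: "0 \<le> r"
    and int1: "integrable M (\<lambda>w. exp (r * (t \<bullet> X w)))"
    and int2: "integrable M (\<lambda>w. exp (r * ((t + s) \<bullet> X w)))"
  shows "(\<integral>w. indicator {w\<in>space M. c \<le> s \<bullet> X w} w * exp (r * (t \<bullet> X w)) \<partial>M)
           \<le> exp (- (r * c)) * (\<integral>w. exp (r * ((t + s) \<bullet> X w)) \<partial>M)"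
proof -
  have "(\<integral>w. indicator {w\<in>space M. c \<le> s \<bullet> X w} w * exp (r * (t \<bullet> X w)) \<partial>M)
      \<le> (\<integral>w. exp (- (r * c)) * exp (r * ((t + s) \<bullet> X w)) \<partial>M)"
  proof (rule integral_mono)
    show "integrable M (\<lambda>w. indicator {w\<in>space M. c \<le> s \<bullet> X w} w * exp (r * (t \<bullet> X w)))"
      by (rule integrable_real_mult_indicator[OF _ int1, simplified mult.commute]) measurable
    show "integrable M (\<lambda>w. exp (- (r * c)) * exp (r * ((t + s) \<bullet> X w)))"
      using int2 by simp
    fix w
    show "indicator {w\<in>space M. c \<le> s \<bullet> X w} w * exp (r * (t \<bullet> X w))
        \<le> exp (- (r * c)) * exp (r * ((t + s) \<bullet> X w))"
    proof (cases "c \<le> s \<bullet> X w")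
      case True
      then have "r * c \<le> r * (s \<bullet> X w)" using r by (rule mult_left_mono)
      then have "r * (t \<bullet> X w) \<le> - (r * c) + r * ((t + s) \<bullet> X w)"
        by (simp add: algebra_simps)
      then show ?thesis by (simp add: indicator_def flip: exp_add)
    qed (simp add: indicator_def)
  qed
  then show ?thesis by simp
qed

lemma halfspace_chernoff:
  fixes X :: "'w \<Rightarrow> 'a::euclidean_space"
  assumes "prob_space M" and X[measurable]: "X \<in> borel_measurable M" and r: "0 \<le> r"
    and int: "integrable M (\<lambda>w. exp (r * (t \<bullet> X w)))"
  shows "measure M {w\<in>space M. c \<le> t \<bullet> X w} \<le> exp (- (r * c)) * (\<integral>w. exp (r * (t \<bullet> X w)) \<partial>M)"
proof -
  interpret prob_space M by fact
  show ?thesis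
    using tilted_chernoff[OF X r, of 0 t c] int by simp
qed

text \<open>Two opposite half-spaces in each coordinate direction cut off a neighbourhood of infinity; what
  is left of the closed set is compact.\<close>

lemma closed_covered_by_finitely_many_halfspaces:
  fixes C :: "'a::euclidean_space set" and \<Lambda> :: "'a \<Rightarrow> real"
  assumes C: "closed C" and ex: "\<And>x. x \<in> C \<Longrightarrow> \<exists>t. \<alpha> + \<Lambda> t < t \<bullet> x"
  shows "\<exists>T. finite T \<and> C \<subseteq> (\<Union>t\<in>T. {x. \<alpha> + \<Lambda> t < t \<bullet> x})"
proof -
  define H where "H t = {x. \<alpha> + \<Lambda> t < t \<bullet> x}" for t
  define B where "B = (Basis :: 'a set) \<union> uminus ` Basis"
  have finB: "finite B" by (simp add: B_def)
  define K where "K = C - (\<Union>t\<in>B. H t)"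
  have opH: "open (H t)" for t
    unfolding H_def by (intro open_Collect_less continuous_intros)
  have "closed K" unfolding K_def using C opH by (intro closed_Diff) auto
  moreover have "bounded K"
  proof -
    \<comment> \<open>The sum of the absolute thresholds dominates each of them, so a single
      \<open>R\<close> bounds all coordinates.\<close>
    define R where "R = (\<Sum>t\<in>B. \<bar>\<alpha> + \<Lambda> t\<bar>)"
    have R: "\<alpha> + \<Lambda> t \<le> R" if "t \<in> B" for t
    proof -
      have "\<bar>\<alpha> + \<Lambda> t\<bar> \<le> R" unfolding R_def using that finB by (intro member_le_sum) auto
      then show ?thesis by linarith
    qed
    have "norm x \<le> real (DIM('a)) * R" if "x \<in> K" for x
    proof -
      have a: "\<bar>x \<bullet> b\<bar> \<le> R" if b: "b \<in> Basis" for b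
      proof -
        have "b \<bullet> x \<le> \<alpha> + \<Lambda> b" "(- b) \<bullet> x \<le> \<alpha> + \<Lambda> (- b)"
          using \<open>x \<in> K\<close> b unfolding K_def H_def B_def by (auto simp: not_less)
        moreover have "\<alpha> + \<Lambda> b \<le> R" "\<alpha> + \<Lambda> (- b) \<le> R"
          using b by (auto intro!: R simp: B_def)
        ultimately show ?thesis by (simp add: inner_commute abs_le_iff)
      qed
      have "norm x \<le> (\<Sum>b\<in>Basis. \<bar>x \<bullet> b\<bar>)" by (rule norm_le_l1)
      also have "\<dots> \<le> (\<Sum>b\<in>(Basis::'a set). R)" by (intro sum_mono a)
      finally show ?thesis by simp
    qed
    then show ?thesis by (auto simp: bounded_iff)
  qed
  ultimately have "compact K" by (simp add: compact_eq_bounded_closed)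
  moreover have "K \<subseteq> (\<Union>t\<in>UNIV. H t)" using ex unfolding K_def H_def by auto
  ultimately obtain T where "finite T" "K \<subseteq> (\<Union>t\<in>T. H t)"
    using opH by (meson compactE_image)
  then have "finite (T \<union> B) \<and> C \<subseteq> (\<Union>t\<in>T \<union> B. H t)"
    using finB unfolding K_def by auto
  then show ?thesis unfolding H_def by blast
qed

text \<open>Absorbs fixed constants, such as the number of half-spaces in a cover, into an
  arbitrarily small exponential rate.\<close>

lemma eventually_le_exp:
  fixes v :: "nat \<Rightarrow> real"
  assumes v: "filterlim v at_top sequentially" and "0 < \<epsilon>"
  shows "\<forall>\<^sub>F n in sequentially. N \<le> exp (v n * \<epsilon>)"
proof -
  have "filterlim (\<lambda>n. exp (v n * \<epsilon>)) at_top sequentially"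
    using filterlim_tendsto_pos_mult_at_top[OF tendsto_const \<open>0 < \<epsilon>\<close> v]
    by (intro filterlim_compose[OF exp_at_top]) (simp add: mult.commute)
  then show ?thesis by (simp add: filterlim_at_top)
qed

text \<open>The hypothesis \<open>mgf\<close> says that \<open>ln (\<integral>w. exp (v n * (t \<bullet> X n w)) \<partial>P n) / v n\<close> converges to
  \<open>(t \<bullet> S t) / 2\<close>.\<close>

locale quadratic_cumulants =
  fixes P :: "nat \<Rightarrow> 'w measure" and X :: "nat \<Rightarrow> 'w \<Rightarrow> 'a::euclidean_space"
    and v :: "nat \<Rightarrow> real" and S :: "'a \<Rightarrow> 'a"
  assumes prob: "\<forall>\<^sub>F n in sequentially. prob_space (P n)"
    and meas: "\<forall>\<^sub>F n in sequentially. X n \<in> borel_measurable (P n)"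
    and integ: "\<And>t. \<forall>\<^sub>F n in sequentially. integrable (P n) (\<lambda>w. exp (v n * (t \<bullet> X n w)))"
    and v_pos: "\<And>n. 0 < v n" and v_top: "filterlim v at_top sequentially"
    and S_linear: "linear S" and S_sym: "\<And>s t. s \<bullet> S t = S s \<bullet> t"
    and mgf: "\<And>t \<epsilon>. 0 < \<epsilon> \<Longrightarrow> \<forall>\<^sub>F n in sequentially.
        exp (v n * ((t \<bullet> S t) / 2 - \<epsilon>)) \<le> (\<integral>w. exp (v n * (t \<bullet> X n w)) \<partial>P n) \<and>
        (\<integral>w. exp (v n * (t \<bullet> X n w)) \<partial>P n) \<le> exp (v n * ((t \<bullet> S t) / 2 + \<epsilon>))"
begin

definition cumulant :: "'a \<Rightarrow> real" where
  "cumulant t = (t \<bullet> S t) / 2"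

definition rate :: "'a \<Rightarrow> ereal" where
  "rate x = (SUP t. ereal (t \<bullet> x - cumulant t))"

section \<open>Upper bound for closed sets\<close>

lemma eventually_prob_closed_le:
  assumes C: "closed C" and less: "\<And>x. x \<in> C \<Longrightarrow> ereal \<alpha> < rate x" and \<epsilon>: "0 < \<epsilon>"
  shows "\<forall>\<^sub>F n in sequentially.
           measure (P n) {w\<in>space (P n). X n w \<in> C} \<le> exp (- (v n * (\<alpha> - \<epsilon>)))"
proof -
  have "\<exists>t. \<alpha> + cumulant t < t \<bullet> x" if "x \<in> C" for x
    using less[OF that] unfolding rate_def less_SUP_iff by (auto simp: algebra_simps)
  from closed_covered_by_finitely_many_halfspaces[OF C this]
  obtain T where T: "finite T" "C \<subseteq> (\<Union>t\<in>T. {x. \<alpha> + cumulant t < t \<bullet> x})" by auto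
  \<comment> \<open>Finitely many \<open>t\<close> admit a common threshold for \<open>n\<close>.
    Half of \<open>\<epsilon>\<close> pays for replacing the integral by its limit, the other half
    for the number of half-spaces in the union bound.\<close>
  have "\<forall>\<^sub>F n in sequentially. \<forall>t\<in>T. integrable (P n) (\<lambda>w. exp (v n * (t \<bullet> X n w))) \<and>
      (\<integral>w. exp (v n * (t \<bullet> X n w)) \<partial>P n) \<le> exp (v n * (cumulant t + \<epsilon> / 2))"
  proof (intro eventually_ball_finite ballI eventually_conj integ T(1))
    fix t
    show "\<forall>\<^sub>F n in sequentially. (\<integral>w. exp (v n * (t \<bullet> X n w)) \<partial>P n) \<le> exp (v n * (cumulant t + \<epsilon> / 2))"
      using mgf[of "\<epsilon> / 2" t] \<epsilon> unfolding cumulant_def by (auto elim: eventually_mono)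
  qed
  moreover have "\<forall>\<^sub>F n in sequentially. real (card T) \<le> exp (v n * (\<epsilon> / 2))"
    using \<epsilon> by (intro eventually_le_exp v_top) auto
  ultimately show ?thesis
    using prob meas
  proof eventually_elim
    case (elim n)
    then interpret prob_space "P n" by simp
    note [measurable] = elim(4)
    have [measurable]: "{w\<in>space (P n). c \<le> t \<bullet> X n w} \<in> sets (P n)" for c t
      by measurable
    have "measure (P n) {w\<in>space (P n). X n w \<in> C}
        \<le> measure (P n) (\<Union>t\<in>T. {w\<in>space (P n). \<alpha> + cumulant t \<le> t \<bullet> X n w})"
    proof (rule finite_measure_mono)
      show "{w\<in>space (P n). X n w \<in> C}
          \<subseteq> (\<Union>t\<in>T. {w\<in>space (P n). \<alpha> + cumulant t \<le> t \<bullet> X n w})"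
        using T(2) by (force dest: less_imp_le)
    qed (intro sets.finite_UN T(1), measurable)
    also have "\<dots> \<le> (\<Sum>t\<in>T. measure (P n) {w\<in>space (P n). \<alpha> + cumulant t \<le> t \<bullet> X n w})"
      by (rule finite_measure_subadditive_finite[OF T(1)]) (use \<open>\<And>c t. {w\<in>space (P n). c \<le> t \<bullet> X n w} \<in> sets (P n)\<close> in blast)
    also have "\<dots> \<le> (\<Sum>t\<in>T. exp (- (v n * (\<alpha> - \<epsilon> / 2))))"
    proof (rule sum_mono)
      fix t assume t: "t \<in> T"
      have "measure (P n) {w\<in>space (P n). \<alpha> + cumulant t \<le> t \<bullet> X n w}
          \<le> exp (- (v n * (\<alpha> + cumulant t))) * (\<integral>w. exp (v n * (t \<bullet> X n w)) \<partial>P n)"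
        using elim t v_pos[of n] by (intro halfspace_chernoff) auto
      also have "\<dots> \<le> exp (- (v n * (\<alpha> + cumulant t))) * exp (v n * (cumulant t + \<epsilon> / 2))"
        using elim t by (intro mult_left_mono) auto
      also have "\<dots> = exp (- (v n * (\<alpha> - \<epsilon> / 2)))"
        by (simp add: algebra_simps flip: exp_add)
      finally show "measure (P n) {w\<in>space (P n). \<alpha> + cumulant t \<le> t \<bullet> X n w}
          \<le> exp (- (v n * (\<alpha> - \<epsilon> / 2)))" .
    qed
    also have "\<dots> = real (card T) * exp (- (v n * (\<alpha> - \<epsilon> / 2)))" by simp
    also have "\<dots> \<le> exp (v n * (\<epsilon> / 2)) * exp (- (v n * (\<alpha> - \<epsilon> / 2)))"
      using elim by (intro mult_right_mono) auto
    also have "\<dots> = exp (- (v n * (\<alpha> - \<epsilon>)))"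
      by (simp add: algebra_simps flip: exp_add)
    finally show ?case .
  qed
qed

text \<open>The infimum may be infinite, so it is approached through levels strictly below it; every
  point of \<open>C\<close> then has rate above the level, and the preceding bound applies with
  arbitrarily small \<open>\<epsilon>\<close>.\<close>

lemma limsup_prob_closed:
  assumes "closed C"
  shows "limsup (\<lambda>n. ereal (1 / v n) * log_prob (measure (P n) {w\<in>space (P n). X n w \<in> C}))
           \<le> - (INF x\<in>C. rate x)"
proof -
  have "limsup (\<lambda>n. ereal (1 / v n) * log_prob (measure (P n) {w\<in>space (P n). X n w \<in> C})) \<le> - y"
    if "y < (INF x\<in>C. rate x)" for y
  proof (cases y)
    case (real r)
    have less: "ereal r < rate x" if "x \<in> C" for x
      using \<open>y < _\<close> real INF_lower[OF that, of rate] by auto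
    have "limsup (\<lambda>n. ereal (1 / v n) * log_prob (measure (P n) {w\<in>space (P n). X n w \<in> C}))
        \<le> ereal (- r) + ereal \<epsilon>" if "0 < \<epsilon>" for \<epsilon>
      using limsup_log_prob_le[OF v_pos _ eventually_prob_closed_le[OF assms less that]] by simp
    then have "limsup (\<lambda>n. ereal (1 / v n) * log_prob (measure (P n) {w\<in>space (P n). X n w \<in> C}))
        \<le> ereal (- r)"
      by (rule ereal_le_epsilon2)
    then show ?thesis using real by simp
  qed (use that in auto)
  then have "y \<le> - limsup (\<lambda>n. ereal (1 / v n) * log_prob (measure (P n) {w\<in>space (P n). X n w \<in> C}))"
    if "y < (INF x\<in>C. rate x)" for y
    using ereal_le_uminus_iff[THEN iffD1] that by blast
  then have "(INF x\<in>C. rate x) \<le> - limsup (\<lambda>n. ereal (1 / v n) * log_prob (measure (P n) {w\<in>space (P n). X n w \<in> C}))"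
    by (rule dense_le)
  then show ?thesis by (rule ereal_le_uminus_iff[THEN iffD1])
qed

section \<open>Lower bound for open sets\<close>

lemma rate_eq_infinity:
  assumes "x \<notin> range S"
  shows "rate x = \<infinity>"
proof -
  \<comment> \<open>\<open>z\<close> is the component of \<open>x\<close> orthogonal to the range of
    \<open>S\<close>. Symmetry puts it in the kernel of \<open>S\<close>, so along multiples of
    \<open>z\<close> the cumulant vanishes while the linear term is unbounded.\<close>
  obtain y z where y: "y \<in> span (range S)" and z: "\<And>w. w \<in> span (range S) \<Longrightarrow> orthogonal z w"
    and x: "x = y + z"
    by (metis orthogonal_subspace_decomp_exists)
  have sp: "span (range S) = range S"
    using S_linear by (intro span_eq_iff[THEN iffD2] linear_subspace_image subspace_UNIV)
  have "z \<noteq> 0" using assms x y sp by auto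
  have "S z \<bullet> w = 0" for w
    using z[of "S w"] sp S_sym by (auto simp: orthogonal_def)
  then have Sz: "S z = 0" by (metis inner_eq_zero_iff)
  have zx: "z \<bullet> x = z \<bullet> z"
    using z[OF y] by (simp add: x orthogonal_def inner_add_right)
  have "ereal (r) \<le> rate x" for r
  proof -
    define c where "c = r / (z \<bullet> z)"
    have eq: "(c *\<^sub>R z) \<bullet> x - cumulant (c *\<^sub>R z) = r"
      using \<open>z \<noteq> 0\<close> by (simp add: c_def cumulant_def zx linear_scale[OF S_linear] Sz)
    have "ereal ((c *\<^sub>R z) \<bullet> x - cumulant (c *\<^sub>R z)) \<le> rate x"
      unfolding rate_def by (rule SUP_upper) simp
    then show ?thesis unfolding eq .
  qed
  then show ?thesis by (rule ereal_top)
qed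

text \<open>Under the measure tilted by \<open>exp (v n * (t \<bullet> X n w))\<close>, the variables \<open>X n\<close> concentrate
  at \<open>S t\<close>.\<close>

lemma eventually_tilted_tail:
  assumes \<epsilon>: "0 < \<epsilon>"
  shows "\<exists>\<delta>>0. \<forall>\<^sub>F n in sequentially.
    (\<integral>w. indicator {w\<in>space (P n). s \<bullet> S t + \<epsilon> \<le> s \<bullet> X n w} w * exp (v n * (t \<bullet> X n w)) \<partial>P n)
      \<le> exp (v n * (cumulant t - \<delta>))"
proof -
  \<comment> \<open>Perturbing the tilt by \<open>c *\<^sub>R s\<close> gains
    \<open>c * \<epsilon>\<close> in the exponent at the quadratic cost
    \<open>c^2 * (s \<bullet> S s) / 2\<close>. This \<open>c\<close> keeps the cost to at most half
    the gain; the \<open>+ 1\<close> avoids division by 0.\<close>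
  define c where "c = \<epsilon> / (\<bar>s \<bullet> S s\<bar> + 1)"
  have c: "0 < c" unfolding c_def using \<epsilon> by auto
  \<comment> \<open>At least half of the gain is left: one quarter pays for the approximation of the
    integral and one quarter is the claimed decay.\<close>
  define \<delta> where "\<delta> = c * \<epsilon> / 4"
  have "0 < \<delta>" using c \<epsilon> by (simp add: \<delta>_def)
  have "c * (s \<bullet> S s) \<le> \<epsilon>"
  proof -
    have "c * (s \<bullet> S s) \<le> c * (\<bar>s \<bullet> S s\<bar> + 1)" using c by (intro mult_left_mono) auto
    also have "\<dots> = \<epsilon>" unfolding c_def by (simp add: field_simps add_nonneg_eq_0_iff)
    finally show ?thesis .
  qed
  then have "c * (c * (s \<bullet> S s)) \<le> c * \<epsilon>" using c by simp
  moreover have "(t + c *\<^sub>R s) \<bullet> S (t + c *\<^sub>R s) = t \<bullet> S t + 2 * c * (s \<bullet> S t) + c * (c * (s \<bullet> S s))"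
    using S_sym[of t s] by (simp add: linear_add[OF S_linear] linear_scale[OF S_linear]
        inner_add_left inner_add_right inner_commute algebra_simps)
  ultimately have key: "cumulant (t + c *\<^sub>R s) + \<delta> \<le> cumulant t - \<delta> + c * (s \<bullet> S t + \<epsilon>)"
    unfolding cumulant_def \<delta>_def distrib_left
    by (simp add: mult.commute[of \<epsilon> c] add_divide_distrib mult.assoc)
  have "\<forall>\<^sub>F n in sequentially.
    (\<integral>w. indicator {w\<in>space (P n). s \<bullet> S t + \<epsilon> \<le> s \<bullet> X n w} w * exp (v n * (t \<bullet> X n w)) \<partial>P n)
      \<le> exp (v n * (cumulant t - \<delta>))"
    using prob meas integ[of t] integ[of "t + c *\<^sub>R s"] mgf[OF \<open>0 < \<delta>\<close>, of "t + c *\<^sub>R s"]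
  proof eventually_elim
    case (elim n)
    have "{w\<in>space (P n). s \<bullet> S t + \<epsilon> \<le> s \<bullet> X n w}
        = {w\<in>space (P n). c * (s \<bullet> S t + \<epsilon>) \<le> (c *\<^sub>R s) \<bullet> X n w}"
      using c by auto
    then have "(\<integral>w. indicator {w\<in>space (P n). s \<bullet> S t + \<epsilon> \<le> s \<bullet> X n w} w * exp (v n * (t \<bullet> X n w)) \<partial>P n)
        \<le> exp (- (v n * (c * (s \<bullet> S t + \<epsilon>)))) * (\<integral>w. exp (v n * ((t + c *\<^sub>R s) \<bullet> X n w)) \<partial>P n)"
      using tilted_chernoff[of "X n" "P n" "v n" t "c *\<^sub>R s"] elim v_pos[of n] by simp
    also have "\<dots> \<le> exp (- (v n * (c * (s \<bullet> S t + \<epsilon>)))) * exp (v n * (cumulant (t + c *\<^sub>R s) + \<delta>))"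
      using elim unfolding cumulant_def by (intro mult_left_mono) auto
    also have "\<dots> = exp (v n * (cumulant (t + c *\<^sub>R s) + \<delta> - c * (s \<bullet> S t + \<epsilon>)))"
      by (simp add: algebra_simps flip: exp_add)
    also have "\<dots> \<le> exp (v n * (cumulant t - \<delta>))"
      using key v_pos[of n] by simp
    finally show ?case .
  qed
  then show ?thesis using \<open>0 < \<delta>\<close> by blast
qed

text \<open>Change of measure: under the tilt by \<open>t\<close> at least half of the mass
  eventually lies in a small ball around \<open>S t\<close>, where the density is almost constant.
  Undoing the tilt costs about \<open>t \<bullet> S t - cumulant t\<close>, the term at
  \<open>t\<close> in the supremum defining \<open>rate (S t)\<close>.\<close>

lemma eventually_prob_open_ge:
  assumes U: "open U" and x: "S t \<in> U" and \<epsilon>: "0 < \<epsilon>"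
  shows "\<forall>\<^sub>F n in sequentially. exp (- (v n * (t \<bullet> S t - cumulant t + \<epsilon>)))
           \<le> measure (P n) {w\<in>space (P n). X n w \<in> U}"
proof -
  obtain e where e: "e > 0" "ball (S t) e \<subseteq> U" using U x by (auto simp: open_contains_ball)
  \<comment> \<open>Small enough for the ball to lie in \<open>U\<close> and for the density there
    to exceed its value at \<open>S t\<close> by a factor of at most
    \<open>exp (v n * \<epsilon> / 2)\<close>; adding 1 covers \<open>t = 0\<close>.\<close>
  define d where "d = min e (\<epsilon> / (2 * (norm t + 1)))"
  have d: "d > 0" "d \<le> e" "norm t * d \<le> \<epsilon> / 2"
  proof -
    show "d > 0" unfolding d_def using e \<epsilon> norm_ge_zero[of t]
      by (auto intro!: divide_pos_pos simp del: norm_ge_zero)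
    show "d \<le> e" by (simp add: d_def)
    have "d \<le> \<epsilon> / (2 * (norm t + 1))" by (simp add: d_def)
    then have "norm t * d \<le> (norm t + 1) * (\<epsilon> / (2 * (norm t + 1)))"
      using \<open>d > 0\<close> by (intro mult_mono) auto
    also have "\<dots> = \<epsilon> / 2"
    proof -
      have "norm t + 1 \<noteq> 0" using norm_ge_zero[of t] by linarith
      then show ?thesis by (metis mult.commute nonzero_mult_divide_mult_cancel_right times_divide_eq_right)
    qed
    finally show "norm t * d \<le> \<epsilon> / 2" .
  qed
  \<comment> \<open>If every coordinate is within \<open>d'\<close>, the 1-norm is at most
    \<open>d / 2\<close>, so half-spaces in the directions \<open>B\<close> cover the complement of
    the ball.\<close>
  define d' where "d' = d / (2 * real DIM('a))"
  have d': "d' > 0" using d by (simp add: d'_def)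
  define B where "B = (Basis :: 'a set) \<union> uminus ` Basis"
  have finB: "finite B" by (simp add: B_def)
  define E where "E n s = {w\<in>space (P n). s \<bullet> S t + d' \<le> s \<bullet> X n w}" for n s
  define F where "F n = {w\<in>space (P n). X n w \<in> ball (S t) d}" for n
  have "\<forall>s. \<exists>\<delta>. \<delta> > 0 \<and> (\<forall>\<^sub>F n in sequentially.
      (\<integral>w. indicator (E n s) w * exp (v n * (t \<bullet> X n w)) \<partial>P n) \<le> exp (v n * (cumulant t - \<delta>)))"
    using eventually_tilted_tail[OF d', of _ t] unfolding E_def by blast
  from choice[OF this] obtain \<delta> where \<delta>: "\<And>s. \<delta> s > 0"
    "\<And>s. \<forall>\<^sub>F n in sequentially. (\<integral>w. indicator (E n s) w * exp (v n * (t \<bullet> X n w)) \<partial>P n)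
      \<le> exp (v n * (cumulant t - \<delta> s))"
    by blast
  \<comment> \<open>A common decay rate; the minimum with \<open>\<epsilon>\<close> makes the later
    error \<open>\<delta>' / 4\<close> fit into a quarter of \<open>\<epsilon>\<close>.\<close>
  define \<delta>' where "\<delta>' = Min (insert \<epsilon> (\<delta> ` B))"
  have "\<delta>' > 0" unfolding \<delta>'_def using finB \<delta>(1) \<epsilon> by (subst Min_gr_iff) auto
  have \<delta>'_le: "\<delta>' \<le> \<delta> s" if "s \<in> B" for s
    unfolding \<delta>'_def using finB that by (intro Min_le) auto
  have \<delta>'_\<epsilon>: "\<delta>' \<le> \<epsilon>"
    unfolding \<delta>'_def using finB by (intro Min_le) auto
  have far: "\<exists>s\<in>B. s \<bullet> S t + d' \<le> s \<bullet> z" if "z \<notin> ball (S t) d" for z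
  proof (rule ccontr)
    assume "\<not> ?thesis"
    then have *: "s \<bullet> z < s \<bullet> S t + d'" if "s \<in> B" for s using that by (auto simp: not_le)
    have "\<bar>(z - S t) \<bullet> b\<bar> \<le> d'" if "b \<in> Basis" for b
      using *[of b] *[of "- b"] that by (auto simp: B_def inner_diff_right inner_commute abs_le_iff)
    then have "norm (z - S t) \<le> (\<Sum>b\<in>(Basis::'a set). d')"
      by (intro order_trans[OF norm_le_l1] sum_mono)
    also have "\<dots> = d / 2" by (simp add: d'_def)
    also have "\<dots> < d" using d by simp
    finally show False using that by (simp add: dist_norm norm_minus_commute)
  qed
  have "\<forall>\<^sub>F n in sequentially. \<forall>s\<in>B.
      (\<integral>w. indicator (E n s) w * exp (v n * (t \<bullet> X n w)) \<partial>P n) \<le> exp (v n * (cumulant t - \<delta> s))"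
    using finB \<delta>(2) by (intro eventually_ball_finite) auto
  moreover have "\<forall>\<^sub>F n in sequentially. 2 * real (card B) \<le> exp (v n * (\<delta>' / 2))"
    using \<open>\<delta>' > 0\<close> by (intro eventually_le_exp v_top) auto
  moreover have "\<forall>\<^sub>F n in sequentially. 2 \<le> exp (v n * (\<epsilon> / 4))"
    using \<epsilon> by (intro eventually_le_exp v_top) auto
  moreover have "\<forall>\<^sub>F n in sequentially. exp (v n * (cumulant t - \<delta>' / 4)) \<le> (\<integral>w. exp (v n * (t \<bullet> X n w)) \<partial>P n)"
    using mgf[of "\<delta>' / 4" t] \<open>\<delta>' > 0\<close> unfolding cumulant_def by (auto elim: eventually_mono)
  ultimately show ?thesis
    using prob meas integ[of t]
  proof eventually_elim
    case (elim n)
    then interpret prob_space "P n" by simp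
    note X[measurable] = elim(6)
    note int = elim(7)
    let ?f = "\<lambda>w. exp (v n * (t \<bullet> X n w))"
    have vn: "v n > 0" by (rule v_pos)
    have E_sets[measurable]: "E n s \<in> sets (P n)" for s
      unfolding E_def by measurable
    have F_sets[measurable]: "F n \<in> sets (P n)"
    proof -
      have [measurable]: "ball (S t) d \<in> sets borel" by simp
      show ?thesis unfolding F_def by measurable
    qed
    have intE: "integrable (P n) (\<lambda>w. indicator (E n s) w * ?f w)" for s
      using integrable_real_mult_indicator[OF E_sets int] by (simp add: mult.commute)
    have intF: "integrable (P n) (\<lambda>w. indicator (F n) w * ?f w)"
      using integrable_real_mult_indicator[OF F_sets int] by (simp add: mult.commute)
    have "(\<integral>w. ?f w \<partial>P n) \<le> (\<integral>w. indicator (F n) w * ?f w + (\<Sum>s\<in>B. indicator (E n s) w * ?f w) \<partial>P n)"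
    proof (rule integral_mono[OF int])
      show "integrable (P n) (\<lambda>w. indicator (F n) w * ?f w + (\<Sum>s\<in>B. indicator (E n s) w * ?f w))"
        using intE intF by auto
      fix w assume w: "w \<in> space (P n)"
      show "?f w \<le> indicator (F n) w * ?f w + (\<Sum>s\<in>B. indicator (E n s) w * ?f w)"
      proof (cases "w \<in> F n")
        case True
        then show ?thesis by (auto intro!: sum_nonneg)
      next
        case False
        then obtain s where s: "s \<in> B" "w \<in> E n s"
          using far[of "X n w"] w unfolding F_def E_def by auto
        then have "?f w = indicator (E n s) w * ?f w" by simp
        also have "\<dots> \<le> (\<Sum>s\<in>B. indicator (E n s) w * ?f w)"
          using s finB by (intro member_le_sum) auto
        finally show ?thesis using False by simp
      qed
    qed
    also have "\<dots> = (\<integral>w. indicator (F n) w * ?f w \<partial>P n) + (\<Sum>s\<in>B. \<integral>w. indicator (E n s) w * ?f w \<partial>P n)"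
      using intE intF by (subst Bochner_Integration.integral_add) (auto intro!: Bochner_Integration.integral_sum)
    finally have split: "(\<integral>w. ?f w \<partial>P n)
        \<le> (\<integral>w. indicator (F n) w * ?f w \<partial>P n) + (\<Sum>s\<in>B. \<integral>w. indicator (E n s) w * ?f w \<partial>P n)" .
    have "2 * (\<Sum>s\<in>B. \<integral>w. indicator (E n s) w * ?f w \<partial>P n) \<le> 2 * (\<Sum>s\<in>B. exp (v n * (cumulant t - \<delta>')))"
    proof (intro mult_left_mono sum_mono)
      fix s assume s: "s \<in> B"
      have "(\<integral>w. indicator (E n s) w * ?f w \<partial>P n) \<le> exp (v n * (cumulant t - \<delta> s))"
        using elim s by auto
      also have "\<dots> \<le> exp (v n * (cumulant t - \<delta>'))"
        using \<delta>'_le[OF s] vn by auto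
      finally show "(\<integral>w. indicator (E n s) w * ?f w \<partial>P n) \<le> exp (v n * (cumulant t - \<delta>'))" .
    qed simp
    also have "\<dots> = 2 * real (card B) * exp (v n * (cumulant t - \<delta>'))" by simp
    also have "\<dots> \<le> exp (v n * (\<delta>' / 2)) * exp (v n * (cumulant t - \<delta>'))"
      using elim by (intro mult_right_mono) auto
    also have "\<dots> = exp (v n * (cumulant t - \<delta>' / 2))"
      by (simp add: algebra_simps flip: exp_add)
    also have "\<dots> \<le> exp (v n * (cumulant t - \<delta>' / 4))"
      using vn \<open>\<delta>' > 0\<close> by simp
    finally have tails: "2 * (\<Sum>s\<in>B. \<integral>w. indicator (E n s) w * ?f w \<partial>P n) \<le> exp (v n * (cumulant t - \<delta>' / 4))" .
    have "(\<integral>w. indicator (F n) w * ?f w \<partial>P n) \<le> (\<integral>w. exp (v n * (t \<bullet> S t + \<epsilon> / 2)) * indicator (F n) w \<partial>P n)"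
    proof (rule integral_mono[OF intF])
      show "integrable (P n) (\<lambda>w. exp (v n * (t \<bullet> S t + \<epsilon> / 2)) * indicator (F n) w)"
        by (intro integrable_mult_right integrable_real_indicator F_sets) (simp add: less_top[symmetric])
      fix w
      show "indicator (F n) w * ?f w \<le> exp (v n * (t \<bullet> S t + \<epsilon> / 2)) * indicator (F n) w"
      proof (cases "w \<in> F n")
        case True
        then have "norm (X n w - S t) \<le> d" by (auto simp: F_def dist_norm norm_minus_commute)
        then have "t \<bullet> (X n w - S t) \<le> norm t * d"
          using norm_cauchy_schwarz[of t "X n w - S t"] mult_left_mono[of "norm (X n w - S t)" d "norm t"]
          by simp
        then have "t \<bullet> X n w \<le> t \<bullet> S t + \<epsilon> / 2" using d by (simp add: inner_diff_right)
        then show ?thesis using vn True by simp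
      qed simp
    qed
    also have "\<dots> = exp (v n * (t \<bullet> S t + \<epsilon> / 2)) * measure (P n) (F n)"
      by simp
    finally have main: "(\<integral>w. indicator (F n) w * ?f w \<partial>P n) \<le> exp (v n * (t \<bullet> S t + \<epsilon> / 2)) * measure (P n) (F n)" .
    \<comment> \<open>The tails take at most half of the lower bound for the whole integral, which
      leaves a factor 2. The budget is \<open>\<epsilon> / 2\<close> for the density,
      \<open>\<epsilon> / 4\<close> for this factor and \<open>\<delta>' / 4\<close> for the
      integral.\<close>
    have "exp (v n * (cumulant t - \<delta>' / 4)) \<le> 2 * (exp (v n * (t \<bullet> S t + \<epsilon> / 2)) * measure (P n) (F n))"
      using split tails main elim(4) by linarith
    also have "\<dots> \<le> exp (v n * (\<epsilon> / 4)) * (exp (v n * (t \<bullet> S t + \<epsilon> / 2)) * measure (P n) (F n))"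
      using elim by (intro mult_right_mono) auto
    also have "\<dots> = exp (v n * (t \<bullet> S t + 3 * \<epsilon> / 4)) * measure (P n) (F n)"
      by (simp add: algebra_simps flip: exp_add)
    finally have "exp (- (v n * (t \<bullet> S t + 3 * \<epsilon> / 4))) * exp (v n * (cumulant t - \<delta>' / 4)) \<le> measure (P n) (F n)"
      by (simp add: exp_minus field_simps)
    moreover have "exp (- (v n * (t \<bullet> S t - cumulant t + \<epsilon>)))
        \<le> exp (- (v n * (t \<bullet> S t + 3 * \<epsilon> / 4))) * exp (v n * (cumulant t - \<delta>' / 4))"
      using mult_left_mono[OF \<delta>'_\<epsilon>, of "v n"] vn by (simp add: algebra_simps flip: exp_add)
    moreover have "measure (P n) (F n) \<le> measure (P n) {w\<in>space (P n). X n w \<in> U}"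
    proof (rule finite_measure_mono)
      have [measurable]: "U \<in> sets borel" using U by auto
      show "{w\<in>space (P n). X n w \<in> U} \<in> sets (P n)" by measurable
    qed (use e d in \<open>auto simp: F_def\<close>)
    ultimately show ?case by linarith
  qed
qed

text \<open>Each point of \<open>U\<close> is treated alone: outside the range of \<open>S\<close>
  the bound is \<open>-\<infinity>\<close>, and at \<open>S t\<close> the change-of-measure bound
  applies with every positive \<open>\<epsilon>\<close>.\<close>

lemma liminf_prob_open:
  assumes U: "open U"
  shows "- (INF x\<in>U. rate x)
           \<le> liminf (\<lambda>n. ereal (1 / v n) * log_prob (measure (P n) {w\<in>space (P n). X n w \<in> U}))"
    (is "_ \<le> ?L")
proof -
  have "- rate x \<le> ?L" if x: "x \<in> U" for x
  proof (cases "x \<in> range S")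
    case False
    then show ?thesis by (simp add: rate_eq_infinity)
  next
    case True
    then obtain t where t: "x = S t" by auto
    have "ereal (- (t \<bullet> S t - cumulant t)) \<le> ?L + ereal \<epsilon>" if "0 < \<epsilon>" for \<epsilon>
    proof -
      have "ereal (- (t \<bullet> S t - cumulant t + \<epsilon>)) \<le> ?L"
        using eventually_prob_open_ge[OF U _ that] x t by (intro liminf_log_prob_ge v_pos) auto
      then have "ereal (- (t \<bullet> S t - cumulant t + \<epsilon>)) + ereal \<epsilon> \<le> ?L + ereal \<epsilon>"
        by (rule add_right_mono)
      then show ?thesis by simp
    qed
    then have "ereal (- (t \<bullet> S t - cumulant t)) \<le> ?L"
      by (rule ereal_le_epsilon2)
    moreover have "ereal (t \<bullet> x - cumulant t) \<le> rate x"
      unfolding rate_def by (rule SUP_upper) simp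
    then have "- rate x \<le> - ereal (t \<bullet> S t - cumulant t)"
      unfolding t by (subst ereal_minus_le_minus)
    ultimately show ?thesis by (simp add: order_trans)
  qed
  then have "- ?L \<le> rate x" if "x \<in> U" for x
    using ereal_uminus_le_reorder[THEN iffD1] that by blast
  then have "- ?L \<le> (INF x\<in>U. rate x)" by (intro INF_greatest)
  then show ?thesis by (rule ereal_uminus_le_reorder[THEN iffD1])
qed

section \<open>Lower semicontinuity of the rate and the large deviation principle\<close>

lemma rate_function_rate: "rate_function rate"
proof -
  have "0 \<le> rate x" for x
  proof -
    have "ereal (0 \<bullet> x - cumulant 0) \<le> rate x"
      unfolding rate_def by (rule SUP_upper) simp
    then show ?thesis by (simp add: cumulant_def zero_ereal_def)
  qed
  moreover have "closed {x. rate x \<le> c}" for c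
  proof -
    \<comment> \<open>Sublevel sets of a supremum of continuous affine functions are intersections
      of closed sets.\<close>
    have "{x. rate x \<le> c} = (\<Inter>t. {x. ereal (t \<bullet> x - cumulant t) \<le> c})"
      unfolding rate_def by (auto simp: SUP_le_iff)
    moreover have "closed {x. ereal (t \<bullet> x - cumulant t) \<le> c}" for t
    proof (cases c)
      case (real r)
      then show ?thesis by (auto intro!: closed_Collect_le continuous_intros)
    qed auto
    ultimately show ?thesis by auto
  qed
  ultimately show ?thesis by (auto simp: rate_function_def)
qed

theorem satisfies_LDP_quadratic: "satisfies_LDP P X v rate"
  unfolding satisfies_LDP_def
proof (intro conjI allI impI)
  show "\<forall>\<^sub>F n in sequentially. prob_space (P n) \<and> X n \<in> borel_measurable (P n)"
    using prob meas by (rule eventually_conj)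
next
  show "0 < v n" for n by (rule v_pos)
next
  show "filterlim v at_top sequentially" by (rule v_top)
next
  show "rate_function rate" by (rule rate_function_rate)
next
  fix U :: "'a set" assume "open U"
  then show "- (INF x\<in>U. rate x)
      \<le> liminf (\<lambda>n. ereal (1 / v n) * log_prob (measure (P n) {w\<in>space (P n). X n w \<in> U}))"
    by (rule liminf_prob_open)
next
  fix C :: "'a set" assume "closed C"
  then show "limsup (\<lambda>n. ereal (1 / v n) * log_prob (measure (P n) {w\<in>space (P n). X n w \<in> C}))
      \<le> - (INF x\<in>C. rate x)"
    by (rule limsup_prob_closed)
qed

end

section \<open>Perron-Frobenius theory of primitive matrices\<close>

lemma mat_pow_0: "mat_pow T 0 = mat 1"
  by (simp add: mat_pow_def)

lemma mat_pow_Suc: "mat_pow T (Suc k) = T ** mat_pow T k"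
  by (simp add: mat_pow_def)

lemma mat_pow_Suc_right: "mat_pow T (Suc k) = mat_pow T k ** T"
  by (induction k) (simp_all add: mat_pow_0 mat_pow_Suc matrix_mul_assoc)

lemma mat_pow_mult_vec_Suc: "mat_pow T (Suc k) *v x = T *v (mat_pow T k *v x)"
  by (simp add: mat_pow_Suc matrix_vector_mul_assoc)

lemma mat_pow_add_mult_vec: "mat_pow T (j + k) *v x = mat_pow T j *v (mat_pow T k *v x)"
  by (induction j) (simp_all add: mat_pow_0 mat_pow_mult_vec_Suc)

lemma transpose_mat_pow: "transpose (mat_pow T k) = mat_pow (transpose T) k"
proof (induction k)
  case (Suc k)
  then show ?case
    using mat_pow_Suc_right[of T k] by (simp add: mat_pow_Suc matrix_transpose_mul)
qed (simp add: mat_pow_0 transpose_mat)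

lemma matrix_vector_mult_nonneg:
  fixes T :: "real^'m^'n"
  assumes "\<And>i j. 0 \<le> T $ i $ j" "\<And>j. 0 \<le> x $ j"
  shows "0 \<le> (T *v x) $ i"
  by (simp add: matrix_vector_mult_def assms sum_nonneg)

lemma mat_pow_mult_vec_nonneg:
  fixes T :: "real^'m^'m"
  assumes "\<And>i j. 0 \<le> T $ i $ j" "\<And>j. 0 \<le> x $ j"
  shows "0 \<le> (mat_pow T k *v x) $ i"
proof (induction k arbitrary: i)
  case 0
  then show ?case by (simp add: mat_pow_0 assms)
next
  case (Suc k)
  then show ?case unfolding mat_pow_mult_vec_Suc by (rule matrix_vector_mult_nonneg[OF assms(1)])
qed

lemma mat_pow_eigenvector:
  fixes T :: "real^'m^'m"
  assumes "T *v x = y *\<^sub>R x"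
  shows "mat_pow T k *v x = y ^ k *\<^sub>R x"
  by (induction k) (simp_all add: mat_pow_0 mat_pow_mult_vec_Suc matrix_vector_mult_scaleR assms)

lemma positive_matrix_vector_mult:
  fixes T :: "real^'m^'n"
  assumes "\<And>i j. 0 < T $ i $ j" "\<And>j. 0 \<le> x $ j" "x \<noteq> 0"
  shows "0 < (T *v x) $ i"
proof -
  obtain j where j: "x $ j \<noteq> 0" using assms(3) by (auto simp: vec_eq_iff)
  then have "0 < x $ j" using assms(2)[of j] by simp
  then have "0 < T $ i $ j * x $ j" using assms(1) by simp
  also have "\<dots> \<le> (\<Sum>j\<in>UNIV. T $ i $ j * x $ j)"
    using assms by (intro member_le_sum) (simp_all add: less_imp_le)
  finally show ?thesis by (simp add: matrix_vector_mult_def)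
qed

lemma inner_pos_vec:
  fixes u x :: "real^'m"
  assumes "\<And>i. 0 < u $ i" "\<And>i. 0 \<le> x $ i" "x \<noteq> 0"
  shows "0 < u \<bullet> x"
proof -
  obtain j where j: "x $ j \<noteq> 0" using assms(3) by (auto simp: vec_eq_iff)
  then have "0 < u $ j * x $ j" using assms(1,2)[of j] by simp
  also have "\<dots> \<le> (\<Sum>j\<in>UNIV. u $ j * x $ j)"
    using assms by (intro member_le_sum) (simp_all add: less_imp_le)
  finally show ?thesis by (simp add: inner_vec_def)
qed

lemma primitive_matrix_transpose:
  assumes "primitive_matrix T"
  shows "primitive_matrix (transpose T)"
proof -
  obtain k where "k \<ge> 1" "\<And>i j. 0 < mat_pow T k $ i $ j"
    using assms unfolding primitive_matrix_def by blast
  moreover have "mat_pow (transpose T) k $ i $ j = mat_pow T k $ j $ i" for i j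
    unfolding transpose_mat_pow[symmetric] by (simp add: transpose_def)
  ultimately show ?thesis
    using assms unfolding primitive_matrix_def by (auto simp: transpose_def)
qed

text \<open>The positive eigenvector is a Brouwer fixed point of the normalised action on the simplex.\<close>

lemma perron_vector_exists:
  fixes T :: "real^'m^'m"
  assumes "primitive_matrix T"
  shows "\<exists>y v. 0 < y \<and> (\<forall>i. 0 < v $ i) \<and> (\<Sum>i\<in>UNIV. v $ i) = 1 \<and> T *v v = y *\<^sub>R v"
proof -
  have nonneg: "\<And>i j. 0 \<le> T $ i $ j" using assms unfolding primitive_matrix_def by blast
  obtain k where k: "k \<ge> 1" "\<And>i j. 0 < mat_pow T k $ i $ j"
    using assms unfolding primitive_matrix_def by blast
  define \<sigma> where "\<sigma> x = (\<Sum>i\<in>UNIV. x $ i)" for x :: "real^'m"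
  define D where "D = {x::real^'m. (\<forall>i. 0 \<le> x $ i) \<and> \<sigma> x = 1}"
  have \<sigma>_inner: "\<sigma> x = 1 \<bullet> x" for x
    by (simp add: \<sigma>_def inner_vec_def)
  have nz: "x \<noteq> 0" if "x \<in> D" for x using that by (auto simp: D_def \<sigma>_def)
  have "compact D"
  proof -
    have "norm x \<le> 1" if "x \<in> D" for x
    proof -
      have "norm x \<le> (\<Sum>i\<in>UNIV. \<bar>x $ i\<bar>)" by (rule norm_le_l1_cart)
      also have "\<dots> = 1" using that by (simp add: D_def \<sigma>_def)
      finally show ?thesis .
    qed
    then have "bounded D" by (auto simp: bounded_iff)
    moreover have "D = (\<Inter>i. {x. 0 \<le> x $ i}) \<inter> {x. \<sigma> x = 1}" by (auto simp: D_def)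
    then have "closed D"
      unfolding \<sigma>_def
      by (auto intro!: closed_INT closed_Int closed_Collect_le closed_Collect_eq continuous_intros)
    ultimately show ?thesis by (simp add: compact_eq_bounded_closed)
  qed
  moreover have "convex D"
    unfolding convex_def D_def \<sigma>_inner
    by (auto simp: inner_add_right)
  moreover have "D \<noteq> {}"
  proof -
    fix i :: 'm
    have "axis i 1 \<in> D" by (auto simp: D_def \<sigma>_def axis_def)
    then show ?thesis by blast
  qed
  moreover
  \<comment> \<open>Normalising requires \<open>T *v x \<noteq> 0\<close>: otherwise the positive
    matrix \<open>mat_pow T k\<close>, with \<open>k \<ge> 1\<close>, would also annihilate the
    nonnegative nonzero vector \<open>x\<close>.\<close>
  have T_pos: "0 < \<sigma> (T *v x)" if x: "x \<in> D" for x
  proof -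
    have x0: "0 \<le> x $ i" for i using x by (simp add: D_def)
    have "T *v x \<noteq> 0"
    proof
      assume "T *v x = 0"
      then have "mat_pow T k *v x = 0"
        using k(1) by (cases k) (simp_all add: mat_pow_Suc_right flip: matrix_vector_mul_assoc)
      moreover have "0 < (mat_pow T k *v x) $ undefined"
        using k(2) x0 nz[OF x] by (rule positive_matrix_vector_mult)
      ultimately show False by simp
    qed
    then show ?thesis
      unfolding \<sigma>_inner using nonneg x0
      by (intro inner_pos_vec) (auto intro: matrix_vector_mult_nonneg)
  qed
  define f where "f x = (1 / \<sigma> (T *v x)) *\<^sub>R (T *v x)" for x
  have "continuous_on D f"
    unfolding f_def \<sigma>_inner
    using T_pos[unfolded \<sigma>_inner]
    by (intro continuous_intros matrix_vector_mult_linear_continuous_on) (auto simp: less_le)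
  moreover have "f \<in> D \<rightarrow> D"
  proof
    fix x assume x: "x \<in> D"
    have "0 \<le> (T *v x) $ i" for i using nonneg x by (intro matrix_vector_mult_nonneg) (auto simp: D_def)
    then show "f x \<in> D"
      using T_pos[OF x] unfolding D_def f_def \<sigma>_inner by auto
  qed
  ultimately obtain v where v: "v \<in> D" "f v = v"
    by (rule brouwer[of D f])
  define y where "y = \<sigma> (T *v v)"
  have y: "0 < y" using T_pos[OF v(1)] by (simp add: y_def)
  have eig: "T *v v = y *\<^sub>R v"
    using v(2) y unfolding f_def y_def[symmetric] by (metis divide_self_if less_irrefl scaleR_one scaleR_scaleR times_divide_eq_right mult.right_neutral)
  \<comment> \<open>The fixed point is only known to be nonnegative; applying the positive power
    makes every coordinate positive.\<close>
  have "0 < v $ i" for i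
  proof -
    have "0 < (mat_pow T k *v v) $ i"
      using k(2) v(1) nz[OF v(1)] by (intro positive_matrix_vector_mult) (auto simp: D_def)
    then have "0 < y ^ k * v $ i" by (simp add: mat_pow_eigenvector[OF eig])
    then show ?thesis using y by (simp add: zero_less_mult_iff)
  qed
  then show ?thesis using y eig v(1) unfolding D_def \<sigma>_def by blast
qed

text \<open>Fixing the coordinate sum makes eigenvectors of different matrices comparable: their
  differences are orthogonal to \<open>1\<close>. The eigenvalue stays existential because it is
  identified with \<open>pf_eigenvalue\<close> only in \<open>perron_frobenius\<close>.\<close>

definition perron_vec :: "real^'m^'m \<Rightarrow> real^'m" where
  "perron_vec T = (SOME v. (\<forall>i. 0 < v $ i) \<and> (\<Sum>i\<in>UNIV. v $ i) = 1 \<and> (\<exists>y>0. T *v v = y *\<^sub>R v))"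

lemma perron_vec:
  assumes "primitive_matrix T"
  shows "0 < perron_vec T $ i" "(\<Sum>i\<in>UNIV. perron_vec T $ i) = 1"
    "\<exists>y>0. T *v perron_vec T = y *\<^sub>R perron_vec T"
proof -
  have "\<exists>v. (\<forall>i. 0 < v $ i) \<and> (\<Sum>i\<in>UNIV. v $ i) = 1 \<and> (\<exists>y>0. T *v v = y *\<^sub>R v)"
    using perron_vector_exists[OF assms] by blast
  from someI_ex[OF this]
  show "0 < perron_vec T $ i" "(\<Sum>i\<in>UNIV. perron_vec T $ i) = 1"
    "\<exists>y>0. T *v perron_vec T = y *\<^sub>R perron_vec T"
    unfolding perron_vec_def[symmetric] by auto
qed

lemma inner_transpose_mult: "u \<bullet> (T *v x) = (transpose T *v u) \<bullet> x" for T :: "real^'m^'m"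
  by (simp add: dot_lmul_matrix transpose_matrix_vector)

text \<open>Equality in the triangle inequality forces a dominant complex eigenvector to be a scalar multiple
  of the vector of its absolute values.\<close>

lemma complex_eigenvalue_less:
  fixes T :: "real^'m^'m"
  assumes T: "primitive_matrix T" and u: "\<And>i. 0 < u $ i" and y: "0 < y"
    and eig: "transpose T *v u = y *\<^sub>R u"
    and w: "complex_eigenvalue T w" "w \<noteq> complex_of_real y"
  shows "cmod w < y"
proof -
  have nonneg: "\<And>i j. 0 \<le> T $ i $ j" using T unfolding primitive_matrix_def by blast
  obtain k where k: "k \<ge> 1" "\<And>i j. 0 < mat_pow T k $ i $ j"
    using T unfolding primitive_matrix_def by blast
  obtain z :: "complex^'m" where z: "z \<noteq> 0"
    "(\<chi> i j. complex_of_real (T $ i $ j)) *v z = w *s z"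
    using w(1) unfolding complex_eigenvalue_def by blast
  have Tz: "(\<Sum>j\<in>UNIV. complex_of_real (T $ i $ j) * z $ j) = w * z $ i" for i
    using arg_cong[OF z(2), of "\<lambda>x. x $ i"] by (simp add: matrix_vector_mult_def)
  define a :: "real^'m" where "a = (\<chi> i. cmod (z $ i))"
  have a0: "0 \<le> a $ i" for i by (simp add: a_def)
  have "a \<noteq> 0" using z(1) by (auto simp: a_def vec_eq_iff)
  have ua: "0 < u \<bullet> a" using u a0 \<open>a \<noteq> 0\<close> by (rule inner_pos_vec)
  have ge: "cmod w * a $ i \<le> (T *v a) $ i" for i
  proof -
    have "cmod w * a $ i = cmod (\<Sum>j\<in>UNIV. complex_of_real (T $ i $ j) * z $ j)"
      unfolding Tz by (simp add: a_def norm_mult)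
    also have "\<dots> \<le> (\<Sum>j\<in>UNIV. cmod (complex_of_real (T $ i $ j) * z $ j))" by (rule norm_sum)
    also have "\<dots> = (T *v a) $ i" using nonneg by (simp add: matrix_vector_mult_def a_def norm_mult)
    finally show ?thesis .
  qed
  have uTa: "u \<bullet> (T *v a) = y * (u \<bullet> a)" unfolding inner_transpose_mult eig by simp
  have "cmod w * (u \<bullet> a) \<le> u \<bullet> (T *v a)"
  proof -
    have "(\<Sum>i\<in>UNIV. u $ i * (cmod w * a $ i)) \<le> (\<Sum>i\<in>UNIV. u $ i * (T *v a) $ i)"
      by (intro sum_mono mult_left_mono ge) (simp add: u less_imp_le)
    then show ?thesis by (simp add: inner_vec_def sum_distrib_left mult.left_commute)
  qed
  then have le: "cmod w \<le> y" using ua unfolding uTa by simp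
  moreover have "cmod w \<noteq> y"
  proof
    assume eq: "cmod w = y"
    \<comment> \<open>Under equality \<open>T *v a - y *\<^sub>R a\<close> is nonnegative and its
      pairing with the positive vector \<open>u\<close> is 0, so it vanishes.\<close>
    have Ta: "T *v a = y *\<^sub>R a"
    proof (rule ccontr)
      assume "T *v a \<noteq> y *\<^sub>R a"
      then have "0 < u \<bullet> (T *v a - y *\<^sub>R a)"
        using ge u eq by (intro inner_pos_vec) auto
      then show False by (simp add: inner_diff_right uTa)
    qed
    have Tka: "mat_pow T k *v a = y ^ k *\<^sub>R a" by (rule mat_pow_eigenvector[OF Ta])
    have Tkz: "(\<Sum>j\<in>UNIV. complex_of_real (mat_pow T k $ i $ j) * z $ j) = w ^ k * z $ i" for i k
    proof (induction k arbitrary: i)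
      case 0
      have "(\<Sum>j\<in>UNIV. complex_of_real (mat 1 $ i $ j) * z $ j) = (\<Sum>j\<in>UNIV. if i = j then z $ j else 0)"
        by (intro sum.cong) (auto simp: mat_def)
      then show ?case by (simp add: mat_pow_0)
    next
      case (Suc k)
      have "(\<Sum>j\<in>UNIV. complex_of_real (mat_pow T (Suc k) $ i $ j) * z $ j)
          = (\<Sum>j\<in>UNIV. \<Sum>l\<in>UNIV. complex_of_real (T $ i $ l) * (complex_of_real (mat_pow T k $ l $ j) * z $ j))"
        by (simp add: mat_pow_Suc matrix_matrix_mult_def sum_distrib_right mult.assoc)
      also have "\<dots> = (\<Sum>l\<in>UNIV. complex_of_real (T $ i $ l) * (\<Sum>j\<in>UNIV. complex_of_real (mat_pow T k $ l $ j) * z $ j))"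
        by (subst sum.swap) (simp add: sum_distrib_left)
      also have "\<dots> = w ^ k * (\<Sum>l\<in>UNIV. complex_of_real (T $ i $ l) * z $ l)"
        unfolding Suc by (simp add: sum_distrib_left mult_ac)
      finally show ?case unfolding Tz by simp
    qed
    \<comment> \<open>An arbitrary row of the positive power: equality in the triangle inequality
      with all weights positive aligns all coordinates of \<open>z\<close>.\<close>
    define i0 :: 'm where "i0 = undefined"
    define p where "p j = mat_pow T k $ i0 $ j" for j
    define s where "s = (\<Sum>j\<in>UNIV. complex_of_real (p j) * z $ j)"
    have norm_s: "cmod s = (\<Sum>j\<in>UNIV. p j * a $ j)"
    proof -
      have "s = w ^ k * z $ i0" unfolding s_def p_def by (rule Tkz)
      then have "cmod s = y ^ k * a $ i0" by (simp add: norm_mult norm_power eq a_def)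
      also have "\<dots> = (mat_pow T k *v a) $ i0" by (simp add: Tka)
      finally show ?thesis by (simp add: matrix_vector_mult_def p_def)
    qed
    have "0 < (mat_pow T k *v a) $ i0" using k(2) a0 \<open>a \<noteq> 0\<close> by (rule positive_matrix_vector_mult)
    then have s0: "0 < cmod s" by (simp add: norm_s matrix_vector_mult_def p_def)
    \<comment> \<open>The unit factor that rotates \<open>s\<close> onto the positive real axis;
      then \<open>Re (c * z $ j) \<le> a $ j\<close> must hold with equality for every
      \<open>j\<close>.\<close>
    define c where "c = cnj s / complex_of_real (cmod s)"
    have cmod_c: "cmod c = 1" using s0 by (simp add: c_def norm_divide)
    have cs: "c * s = complex_of_real (cmod s)"
    proof -
      have "c * s = s * cnj s / complex_of_real (cmod s)" by (simp add: c_def)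
      also have "\<dots> = complex_of_real ((cmod s)\<^sup>2) / complex_of_real (cmod s)"
        by (simp add: complex_norm_square del: of_real_power)
      also have "\<dots> = complex_of_real (cmod s)" using s0 by (simp add: power2_eq_square)
      finally show ?thesis .
    qed
    have le_a: "Re (c * z $ j) \<le> a $ j" for j
      using complex_Re_le_cmod[of "c * z $ j"] by (simp add: norm_mult cmod_c a_def)
    have "(\<Sum>j\<in>UNIV. p j * (a $ j - Re (c * z $ j))) = cmod s - Re (c * s)"
    proof -
      have "Re (c * s) = (\<Sum>j\<in>UNIV. p j * Re (c * z $ j))"
        by (simp add: s_def sum_distrib_left algebra_simps)
      then show ?thesis by (simp add: norm_s right_diff_distrib sum_subtractf)
    qed
    also have "\<dots> = 0" by (simp add: cs)
    finally have sum0: "(\<Sum>j\<in>UNIV. p j * (a $ j - Re (c * z $ j))) = 0" .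
    have cz: "c * z $ j = complex_of_real (a $ j)" for j
    proof -
      have "p j * (a $ j - Re (c * z $ j)) = 0"
        using sum0 k(2) le_a by (subst (asm) sum_nonneg_eq_0_iff) (auto simp: p_def less_imp_le)
      then have re: "Re (c * z $ j) = a $ j" using k(2)[of i0 j] by (simp add: p_def)
      have "(cmod (c * z $ j))\<^sup>2 = (Re (c * z $ j))\<^sup>2 + (Im (c * z $ j))\<^sup>2" by (rule cmod_power2)
      then have "Im (c * z $ j) = 0" using re by (simp add: norm_mult cmod_c a_def)
      then show ?thesis using re by (simp add: complex_eq_iff)
    qed
    \<comment> \<open>Since \<open>c * z\<close> is real and equals \<open>a\<close>, the eigenvalue
      can be read off at a nonzero coordinate.\<close>
    obtain i where i: "z $ i \<noteq> 0" using z(1) by (auto simp: vec_eq_iff)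
    have "w * (c * z $ i) = c * (w * z $ i)" by simp
    also have "\<dots> = (\<Sum>j\<in>UNIV. complex_of_real (T $ i $ j) * (c * z $ j))"
      by (simp add: sum_distrib_left mult_ac flip: Tz)
    also have "\<dots> = complex_of_real ((T *v a) $ i)"
      by (simp add: cz matrix_vector_mult_def)
    also have "\<dots> = complex_of_real y * (c * z $ i)" by (simp add: Ta cz)
    finally have "w = complex_of_real y" using i s0 by (simp add: c_def)
    with w(2) show False by simp
  qed
  ultimately show ?thesis by simp
qed

text \<open>A positive left eigenvector forces strict dominance of \<open>y\<close> over all other
  complex eigenvalues. Two strictly dominant eigenvalues would each exceed the other in modulus, so
  only \<open>y\<close> meets the description in \<open>pf_eigenvalue\<close>.\<close>

lemma pf_eigenvalue_eqI:
  fixes T :: "real^'m^'m"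
  assumes T: "primitive_matrix T" and u: "\<And>i. 0 < u $ i" and y: "0 < y"
    and eig: "transpose T *v u = y *\<^sub>R u" and v: "T *v v = y *\<^sub>R v" "v \<noteq> 0"
  shows "pf_eigenvalue T = y"
proof -
  let ?P = "\<lambda>z. complex_eigenvalue T z \<and> (\<forall>w. complex_eigenvalue T w \<and> w \<noteq> z \<longrightarrow> cmod w < cmod z)"
  have ev: "complex_eigenvalue T (complex_of_real y)"
    unfolding complex_eigenvalue_def
  proof (intro exI conjI)
    show "(\<chi> i. complex_of_real (v $ i)) \<noteq> 0" using v(2) by (auto simp: vec_eq_iff)
    have "(\<Sum>j\<in>UNIV. T $ i $ j * v $ j) = y * v $ i" for i
      using arg_cong[OF v(1), of "\<lambda>x. x $ i"] by (simp add: matrix_vector_mult_def)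
    then show "(\<chi> i j. complex_of_real (T $ i $ j)) *v (\<chi> i. complex_of_real (v $ i))
        = complex_of_real y *s (\<chi> i. complex_of_real (v $ i))"
      by (simp add: vec_eq_iff matrix_vector_mult_def flip: of_real_mult of_real_sum)
  qed
  moreover have "cmod w < y" if "complex_eigenvalue T w" "w \<noteq> complex_of_real y" for w
    using T u y eig that by (rule complex_eigenvalue_less)
  ultimately have "?P (complex_of_real y)" using y by simp
  moreover have "z = complex_of_real y" if "?P z" for z
    using that ev \<open>?P (complex_of_real y)\<close> by (metis less_asym)
  ultimately have "(THE z. ?P z) = complex_of_real y" by (rule the_equality)
  then show ?thesis by (simp add: pf_eigenvalue_def)
qed

text \<open>The positive right and left eigenvectors could a priori have different eigenvalues;
  evaluating \<open>?u \<bullet> (T *v ?v)\<close> from both sides, with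
  \<open>?u \<bullet> ?v\<close> positive, identifies them.\<close>

lemma perron_frobenius:
  fixes T :: "real^'m^'m"
  assumes T: "primitive_matrix T"
  shows "0 < pf_eigenvalue T" "T *v perron_vec T = pf_eigenvalue T *\<^sub>R perron_vec T"
    "transpose T *v perron_vec (transpose T) = pf_eigenvalue T *\<^sub>R perron_vec (transpose T)"
proof -
  note T' = primitive_matrix_transpose[OF T]
  obtain y where y: "0 < y" "T *v perron_vec T = y *\<^sub>R perron_vec T"
    using perron_vec(3)[OF T] by blast
  obtain y' where y': "0 < y'" "transpose T *v perron_vec (transpose T) = y' *\<^sub>R perron_vec (transpose T)"
    using perron_vec(3)[OF T'] by blast
  let ?u = "perron_vec (transpose T)" and ?v = "perron_vec T"
  have v0: "?v \<noteq> 0" using perron_vec(1)[OF T] by (metis less_irrefl zero_index)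
  have "0 < ?u \<bullet> ?v"
    using perron_vec(1)[OF T] perron_vec(1)[OF T'] v0 by (intro inner_pos_vec) (auto intro: less_imp_le)
  moreover have "y * (?u \<bullet> ?v) = y' * (?u \<bullet> ?v)"
    using inner_transpose_mult[of ?u T ?v] unfolding y(2) y'(2) by simp
  ultimately have "y = y'" by simp
  then have "pf_eigenvalue T = y"
    using y y' perron_vec(1)[OF T'] v0 by (intro pf_eigenvalue_eqI[OF T, where u = ?u]) auto
  then show "0 < pf_eigenvalue T" "T *v perron_vec T = pf_eigenvalue T *\<^sub>R perron_vec T"
    "transpose T *v perron_vec (transpose T) = pf_eigenvalue T *\<^sub>R perron_vec (transpose T)"
    using y y' \<open>y = y'\<close> by auto
qed

text \<open>Subtract the largest multiple of the Perron vector that stays below \<open>x\<close>.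
  The remainder lies in the same eigenspace, is nonnegative and has a zero coordinate, which the
  positive power of \<open>T\<close> forbids unless it is 0.\<close>

lemma perron_eigenspace:
  fixes T :: "real^'m^'m"
  assumes T: "primitive_matrix T" and x: "T *v x = pf_eigenvalue T *\<^sub>R x"
  shows "\<exists>c. x = c *\<^sub>R perron_vec T"
proof -
  let ?v = "perron_vec T" and ?y = "pf_eigenvalue T"
  have v: "0 < ?v $ i" for i by (rule perron_vec(1)[OF T])
  obtain k where k: "k \<ge> 1" "\<And>i j. 0 < mat_pow T k $ i $ j"
    using T unfolding primitive_matrix_def by blast
  define c where "c = Min (range (\<lambda>i. x $ i / ?v $ i))"
  have "c \<in> range (\<lambda>i. x $ i / ?v $ i)" unfolding c_def by (intro Min_in) auto
  then obtain i where i: "c = x $ i / ?v $ i" by blast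
  have c_le: "c \<le> x $ j / ?v $ j" for j unfolding c_def by (intro Min_le) auto
  define z where "z = x - c *\<^sub>R ?v"
  have z0: "0 \<le> z $ j" for j using c_le[of j] v[of j] by (simp add: z_def field_simps)
  have zi: "z $ i = 0" using i v[of i] by (simp add: z_def)
  have "T *v z = ?y *\<^sub>R z"
    by (simp add: z_def matrix_vector_mult_diff_distrib matrix_vector_mult_scaleR x
        perron_frobenius(2)[OF T] scaleR_diff_right)
  from mat_pow_eigenvector[OF this] have "(mat_pow T k *v z) $ i = 0" by (simp add: zi)
  moreover have "0 < (mat_pow T k *v z) $ i" if "z \<noteq> 0"
    using k(2) z0 that by (rule positive_matrix_vector_mult)
  ultimately have "z = 0" by fastforce
  then show ?thesis by (auto simp: z_def)
qed

section \<open>Differentiability of the Perron eigenvalue and eigenvector\<close>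

text \<open>A differentiable factor that vanishes at \<open>s\<close> may be multiplied by a merely
  continuous one: the cross term is of first order times \<open>k t - k s\<close>, which tends to 0.
  This allows Perron identities to be differentiated while the Perron vector is only known to be
  continuous.\<close>

lemma has_derivative_prod_vanishing:
  fixes prod :: "'a::real_normed_vector \<Rightarrow> 'b::real_normed_vector \<Rightarrow> 'c::real_normed_vector"
    and h :: "'d::real_normed_vector \<Rightarrow> 'a" and k :: "'d \<Rightarrow> 'b"
  assumes "bounded_bilinear prod"
    and h: "(h has_derivative h') (at s)" and k: "isCont k s"
  shows "((\<lambda>t. prod (h t - h s) (k t)) has_derivative (\<lambda>d. prod (h' d) (k s))) (at s)"
proof -
  interpret bounded_bilinear prod by fact
  obtain K where K: "0 < K" "\<And>a b. norm (prod a b) \<le> norm a * norm b * K"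
    using pos_bounded by blast
  obtain B where B: "0 < B" "\<And>x. norm (h' x) \<le> norm x * B"
    using h has_derivative_bounded_linear bounded_linear.pos_bounded by blast
  have "((\<lambda>t. prod (h t - h s) (k s)) has_derivative (\<lambda>d. prod (h' d) (k s))) (at s)"
    using has_derivative_diff[OF h has_derivative_const]
    by (intro bounded_linear.has_derivative[OF bounded_linear_left]) simp
  moreover have "((\<lambda>t. prod (h t - h s) (k t - k s)) has_derivative (\<lambda>d. 0)) (at s)"
    unfolding has_derivative_at_alt
  proof (intro conjI allI impI)
    show "bounded_linear (\<lambda>d. 0)" by (rule bounded_linear_zero)
    fix e :: real assume e: "0 < e"
    \<comment> \<open>\<open>1 + B\<close> bounds the local growth of \<open>h\<close> at
      \<open>s\<close> and \<open>K\<close> is the constant of \<open>prod\<close>; the division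
      makes the final bound exactly \<open>e\<close>.\<close>
    define e' where "e' = e / (K * (1 + B))"
    have e': "0 < e'" using e K B by (simp add: e'_def)
    obtain d1 where d1: "0 < d1" "\<And>y. norm (y - s) < d1 \<Longrightarrow> norm (h y - h s - h' (y - s)) \<le> 1 * norm (y - s)"
      using h unfolding has_derivative_at_alt by (metis zero_less_one)
    obtain d2 where d2: "0 < d2" "\<And>y. norm (y - s) < d2 \<Longrightarrow> norm (k y - k s) < e'"
      using k e' unfolding continuous_at_eps_delta by (metis dist_norm)
    show "\<exists>d>0. \<forall>y. norm (y - s) < d \<longrightarrow>
        norm (prod (h y - h s) (k y - k s) - prod (h s - h s) (k s - k s) - 0) \<le> e * norm (y - s)"
    proof (intro exI conjI allI impI)
      show "0 < min d1 d2" using d1 d2 by simp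
      fix y assume y: "norm (y - s) < min d1 d2"
      have "norm (h y - h s) \<le> norm (h y - h s - h' (y - s)) + norm (h' (y - s))"
        by (metis diff_add_cancel norm_triangle_ineq)
      also have "\<dots> \<le> norm (y - s) * (1 + B)"
        using d1(2)[of y] y B(2)[of "y - s"] by (simp add: distrib_left)
      finally have "norm (h y - h s) * norm (k y - k s) * K \<le> (norm (y - s) * (1 + B)) * e' * K"
        using d2(2)[of y] y B(1) K(1) e' by (intro mult_right_mono mult_mono) auto
      also have "\<dots> = e * norm (y - s)"
      proof -
        have "K * (1 + B) \<noteq> 0" using K B by auto
        have "(norm (y - s) * (1 + B)) * e' * K = norm (y - s) * (e' * (K * (1 + B)))" by simp
        also have "e' * (K * (1 + B)) = e"
          unfolding e'_def using \<open>K * (1 + B) \<noteq> 0\<close> by (rule nonzero_eq_divide_eq[THEN iffD1]) simp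
        finally show ?thesis by simp
      qed
      finally show "norm (prod (h y - h s) (k y - k s) - prod (h s - h s) (k s - k s) - 0) \<le> e * norm (y - s)"
        using K(2)[of "h y - h s" "k y - k s"] by (simp add: zero_left)
    qed
  qed
  ultimately have "((\<lambda>t. prod (h t - h s) (k s) + prod (h t - h s) (k t - k s))
      has_derivative (\<lambda>d. prod (h' d) (k s) + 0)) (at s)"
    by (rule has_derivative_add)
  then show ?thesis by (simp add: diff_right)
qed

lemma bounded_bilinear_matrix_vector_mult:
  "bounded_bilinear ((*v) :: real^'m^'m \<Rightarrow> real^'m \<Rightarrow> real^'m)"
  unfolding bilinear_conv_bounded_bilinear[symmetric] bilinear_def
  by (auto intro!: linearI simp: matrix_vector_mult_add_rdistrib matrix_vector_right_distrib
      matrix_vector_mult_scaleR scaleR_matrix_vector_assoc)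

lemma norm_perron_vec_le:
  assumes "primitive_matrix T"
  shows "norm (perron_vec T) \<le> 1"
proof -
  have "norm (perron_vec T) \<le> (\<Sum>i\<in>UNIV. \<bar>perron_vec T $ i\<bar>)" by (rule norm_le_l1_cart)
  also have "\<dots> = (\<Sum>i\<in>UNIV. perron_vec T $ i)"
    using perron_vec(1)[OF assms] by (intro sum.cong) (simp_all add: abs_of_pos)
  finally show ?thesis by (simp add: perron_vec(2)[OF assms])
qed

text \<open>Pairing with the left eigenvector of \<open>S\<close> removes the variation of the right eigenvector.\<close>

lemma pf_eigenvalue_diff:
  assumes S: "primitive_matrix S" and T: "primitive_matrix T"
  defines "u \<equiv> perron_vec (transpose S)"
  shows "(pf_eigenvalue T - pf_eigenvalue S) * (u \<bullet> perron_vec T) = u \<bullet> ((T - S) *v perron_vec T)"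
proof -
  have "u \<bullet> (S *v perron_vec T) = pf_eigenvalue S * (u \<bullet> perron_vec T)"
    unfolding inner_transpose_mult u_def perron_frobenius(3)[OF S] by simp
  moreover have "u \<bullet> (T *v perron_vec T) = pf_eigenvalue T * (u \<bullet> perron_vec T)"
    unfolding perron_frobenius(2)[OF T] by simp
  ultimately show ?thesis
    by (simp add: matrix_vector_mult_diff_rdistrib inner_diff_right left_diff_distrib)
qed

lemma inner_perron_vec_pos:
  assumes S: "primitive_matrix S" and T: "primitive_matrix T"
  shows "0 < perron_vec (transpose S) \<bullet> perron_vec T"
proof -
  have "perron_vec T \<noteq> 0" using perron_vec(1)[OF T] by (metis less_irrefl zero_index)
  then show ?thesis
    using perron_vec(1)[OF primitive_matrix_transpose[OF S]] perron_vec(1)[OF T]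
    by (intro inner_pos_vec) (auto intro: less_imp_le)
qed

text \<open>In the identity of \<open>pf_eigenvalue_diff\<close> the pairing with the left vector is
  at least its smallest coordinate, because \<open>perron_vec T\<close> has positive entries with
  sum 1. The constant therefore depends on \<open>S\<close> alone.\<close>

lemma pf_eigenvalue_lipschitz:
  assumes S: "primitive_matrix S"
  shows "\<exists>C\<ge>0. \<forall>T. primitive_matrix T \<longrightarrow> \<bar>pf_eigenvalue T - pf_eigenvalue S\<bar> \<le> C * norm (T - S)"
proof -
  let ?u = "perron_vec (transpose S)"
  define m where "m = Min (range (\<lambda>i. ?u $ i))"
  have m: "0 < m" using perron_vec(1)[OF primitive_matrix_transpose[OF S]] unfolding m_def
    by (subst Min_gr_iff) auto
  have m_le: "m \<le> ?u $ i" for i unfolding m_def by (intro Min_le) auto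
  interpret bounded_bilinear "(*v) :: real^'a^'a \<Rightarrow> real^'a \<Rightarrow> real^'a"
    by (rule bounded_bilinear_matrix_vector_mult)
  obtain K where K: "0 < K" "\<And>(a::real^'a^'a) b. norm (a *v b) \<le> norm a * norm b * K"
    using pos_bounded by blast
  show ?thesis
  proof (intro exI conjI allI impI)
    show "0 \<le> norm ?u * K / m" using m K by simp
    fix T :: "real^'a^'a" assume T: "primitive_matrix T"
    let ?v = "perron_vec T"
    have "m = (\<Sum>i\<in>UNIV. m * ?v $ i)" by (simp add: perron_vec(2)[OF T] flip: sum_distrib_left)
    also have "\<dots> \<le> (\<Sum>i\<in>UNIV. ?u $ i * ?v $ i)"
      using m_le perron_vec(1)[OF T] by (intro sum_mono mult_right_mono) (auto intro: less_imp_le)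
    finally have uv: "m \<le> ?u \<bullet> ?v" by (simp add: inner_vec_def)
    have "\<bar>pf_eigenvalue T - pf_eigenvalue S\<bar> * m \<le> \<bar>pf_eigenvalue T - pf_eigenvalue S\<bar> * (?u \<bullet> ?v)"
      using uv by (intro mult_left_mono) auto
    also have "\<dots> = \<bar>?u \<bullet> ((T - S) *v ?v)\<bar>"
      using inner_perron_vec_pos[OF S T] by (simp add: abs_mult flip: pf_eigenvalue_diff[OF S T])
    also have "\<dots> \<le> norm ?u * (norm (T - S) * norm ?v * K)"
      using Cauchy_Schwarz_ineq2 K(2) by (rule order_trans[OF _ mult_left_mono]) auto
    also have "\<dots> \<le> norm ?u * (norm (T - S) * 1 * K)"
      using norm_perron_vec_le[OF T] K(1) by (intro mult_left_mono mult_right_mono) auto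
    finally show "\<bar>pf_eigenvalue T - pf_eigenvalue S\<bar> \<le> norm ?u * K / m * norm (T - S)"
      using m by (simp add: field_simps)
  qed
qed

text \<open>Adding the rank-one operator \<open>x \<mapsto> (\<Sum>i. x $ i) *\<^sub>R v\<close> to the singular operator \<open>S - y\<close> makes it
  invertible, and it vanishes on differences of normalised eigenvectors.\<close>

lemma perron_vec_diff:
  fixes S :: "real^'m^'m"
  assumes S: "primitive_matrix S"
  shows "\<exists>R. bounded_linear R \<and> (\<forall>T. primitive_matrix T \<longrightarrow> perron_vec T - perron_vec S =
    R ((pf_eigenvalue T - pf_eigenvalue S) *\<^sub>R perron_vec T - (T - S) *v perron_vec T))"
proof -
  let ?v = "perron_vec S" and ?y = "pf_eigenvalue S" and ?u = "perron_vec (transpose S)"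
  define L where "L x = (S *v x - ?y *\<^sub>R x) + (1 \<bullet> x) *\<^sub>R ?v" for x
  have one_v: "1 \<bullet> perron_vec T = 1" if "primitive_matrix T" for T :: "real^'m^'m"
    using perron_vec(2)[OF that] by (simp add: inner_vec_def)
  have lin: "linear L"
    unfolding L_def
    by (intro linearI) (simp_all add: matrix_vector_right_distrib matrix_vector_mult_scaleR
        inner_add_right algebra_simps)
  have "x = 0" if "L x = 0" for x
  proof -
    \<comment> \<open>Pairing \<open>L x = 0\<close> with the left eigenvector removes the singular
      part and leaves \<open>1 \<bullet> x = 0\<close>. Then \<open>x\<close> is a multiple of
      \<open>?v\<close> with coordinate sum 0, hence 0.\<close>
    have "?u \<bullet> (S *v x) = ?y * (?u \<bullet> x)"
      unfolding inner_transpose_mult perron_frobenius(3)[OF S] by simp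
    then have "?u \<bullet> L x = (1 \<bullet> x) * (?u \<bullet> ?v)"
      by (simp add: L_def inner_add_right inner_diff_right)
    then have 1: "1 \<bullet> x = 0" using that inner_perron_vec_pos[OF S S] by simp
    then have "S *v x = ?y *\<^sub>R x" using that by (simp add: L_def)
    then obtain c where c: "x = c *\<^sub>R ?v" using perron_eigenspace[OF S] by blast
    then show "x = 0" using 1 one_v[OF S] by simp
  qed
  then have "inj L" using lin linear_injective_0 by blast
  then obtain R where R: "linear R" "R \<circ> L = id"
    using linear_injective_left_inverse[OF lin] by blast
  have "bounded_linear R" using R(1) by (simp add: linear_conv_bounded_linear)
  moreover have "perron_vec T - perron_vec S =
      R ((pf_eigenvalue T - pf_eigenvalue S) *\<^sub>R perron_vec T - (T - S) *v perron_vec T)"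
    if T: "primitive_matrix T" for T
  proof -
    have "L (perron_vec T - ?v)
        = (pf_eigenvalue T - ?y) *\<^sub>R perron_vec T - (T - S) *v perron_vec T"
      unfolding L_def
      by (simp add: matrix_vector_mult_diff_distrib matrix_vector_mult_diff_rdistrib inner_diff_right
          one_v[OF S] one_v[OF T] perron_frobenius(2)[OF S] perron_frobenius(2)[OF T] algebra_simps)
    then show ?thesis using R(2) by (metis comp_apply id_apply)
  qed
  ultimately show ?thesis by blast
qed

text \<open>Stated for an abstract family so that it covers both the tilted matrices and their
  transposes, which supply the right and the left Perron vectors.\<close>

locale differentiable_primitive =
  fixes N :: "'a::real_normed_vector \<Rightarrow> real^'m^'m" and s :: 'a and N'
  assumes prim: "\<And>t. primitive_matrix (N t)"
    and deriv: "(N has_derivative N') (at s)"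
begin

lemma isCont_N: "isCont N s"
  using deriv has_derivative_continuous by blast

lemma isCont_pf_eigenvalue: "isCont (\<lambda>t. pf_eigenvalue (N t)) s"
proof -
  obtain C where C: "\<And>T. primitive_matrix T \<Longrightarrow> \<bar>pf_eigenvalue T - pf_eigenvalue (N s)\<bar> \<le> C * norm (T - N s)"
    using pf_eigenvalue_lipschitz[OF prim[of s]] by blast
  have "((\<lambda>t. C * norm (N t - N s)) \<longlongrightarrow> C * norm (N s - N s)) (at s)"
    using isCont_N unfolding isCont_def by (intro tendsto_intros)
  have "((\<lambda>t. pf_eigenvalue (N t) - pf_eigenvalue (N s)) \<longlongrightarrow> 0) (at s)"
  proof (rule Lim_null_comparison[rotated])
    show "((\<lambda>t. C * norm (N t - N s)) \<longlongrightarrow> 0) (at s)"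
      using \<open>((\<lambda>t. C * norm (N t - N s)) \<longlongrightarrow> C * norm (N s - N s)) (at s)\<close> by simp
    show "\<forall>\<^sub>F t in at s. norm (pf_eigenvalue (N t) - pf_eigenvalue (N s)) \<le> C * norm (N t - N s)"
      using C[OF prim] by (intro always_eventually allI) simp
  qed
  then show ?thesis unfolding isCont_def by (rule LIM_zero_cancel)
qed

text \<open>Both terms to which the operator of \<open>perron_vec_diff\<close> is applied are
  products of a factor tending to 0 and the uniformly bounded Perron vectors.\<close>

lemma isCont_perron_vec: "isCont (\<lambda>t. perron_vec (N t)) s"
proof -
  obtain R where R: "bounded_linear R" and eq: "\<And>T. primitive_matrix T \<Longrightarrow> perron_vec T - perron_vec (N s) =
    R ((pf_eigenvalue T - pf_eigenvalue (N s)) *\<^sub>R perron_vec T - (T - N s) *v perron_vec T)"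
    using perron_vec_diff[OF prim[of s]] by blast
  have bd: "Bfun (\<lambda>t. perron_vec (N t)) (at s)"
    using norm_perron_vec_le[OF prim] by (intro BfunI[where K = 1]) auto
  have "((\<lambda>t. pf_eigenvalue (N t) - pf_eigenvalue (N s)) \<longlongrightarrow> 0) (at s)"
    using isCont_pf_eigenvalue unfolding isCont_def by (rule LIM_zero)
  then have "Zfun (\<lambda>t. (pf_eigenvalue (N t) - pf_eigenvalue (N s)) *\<^sub>R perron_vec (N t)) (at s)"
    using bd by (intro bounded_bilinear.Zfun_prod_Bfun[OF bounded_bilinear_scaleR]) (simp_all add: tendsto_Zfun_iff)
  moreover have "((\<lambda>t. N t - N s) \<longlongrightarrow> 0) (at s)"
    using isCont_N unfolding isCont_def by (rule LIM_zero)
  then have "Zfun (\<lambda>t. (N t - N s) *v perron_vec (N t)) (at s)"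
    using bd by (intro bounded_bilinear.Zfun_prod_Bfun[OF bounded_bilinear_matrix_vector_mult]) (simp_all add: tendsto_Zfun_iff)
  ultimately have "Zfun (\<lambda>t. perron_vec (N t) - perron_vec (N s)) (at s)"
    unfolding eq[OF prim] by (intro bounded_linear.Zfun[OF R] Zfun_diff)
  then show ?thesis unfolding isCont_def tendsto_Zfun_iff .
qed

text \<open>Dividing the identity of \<open>pf_eigenvalue_diff\<close> by the pairing leaves an
  increment of \<open>N\<close> times the continuous vector \<open>?k t\<close>; this yields the
  usual first-order perturbation formula.\<close>

lemma has_derivative_pf_eigenvalue:
  "((\<lambda>t. pf_eigenvalue (N t)) has_derivative
    (\<lambda>d. (perron_vec (transpose (N s)) \<bullet> (N' d *v perron_vec (N s))) /
         (perron_vec (transpose (N s)) \<bullet> perron_vec (N s)))) (at s)"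
proof -
  let ?u = "perron_vec (transpose (N s))"
  let ?k = "\<lambda>t. (1 / (?u \<bullet> perron_vec (N t))) *\<^sub>R perron_vec (N t)"
  have pos: "0 < ?u \<bullet> perron_vec (N t)" for t by (rule inner_perron_vec_pos[OF prim prim])
  have "isCont ?k s"
    using pos[of s] by (intro continuous_intros isCont_perron_vec) auto
  then have "((\<lambda>t. pf_eigenvalue (N s) + ?u \<bullet> ((N t - N s) *v ?k t)) has_derivative
      (\<lambda>d. 0 + ?u \<bullet> (N' d *v ?k s))) (at s)"
    by (intro has_derivative_add has_derivative_const has_derivative_inner_right
        has_derivative_prod_vanishing[OF bounded_bilinear_matrix_vector_mult deriv])
  moreover have "pf_eigenvalue (N s) + ?u \<bullet> ((N t - N s) *v ?k t) = pf_eigenvalue (N t)" for t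
    using pf_eigenvalue_diff[OF prim[of s] prim[of t]] pos[of t]
    by (simp add: matrix_vector_mult_scaleR field_simps)
  ultimately show ?thesis by (simp add: matrix_vector_mult_scaleR)
qed

text \<open>The operator \<open>R\<close> is fixed at \<open>s\<close>, and each term inside is an
  increment vanishing at \<open>s\<close> times the continuous Perron vector.\<close>

lemma differentiable_perron_vec: "(\<lambda>t. perron_vec (N t)) differentiable (at s)"
proof -
  obtain R where R: "bounded_linear R" and eq: "\<And>T. primitive_matrix T \<Longrightarrow> perron_vec T - perron_vec (N s) =
    R ((pf_eigenvalue T - pf_eigenvalue (N s)) *\<^sub>R perron_vec T - (T - N s) *v perron_vec T)"
    using perron_vec_diff[OF prim[of s]] by blast
  have "(\<lambda>t. (pf_eigenvalue (N t) - pf_eigenvalue (N s)) *\<^sub>R perron_vec (N t)) differentiable (at s)"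
    by (rule differentiableI[OF has_derivative_prod_vanishing[OF bounded_bilinear_scaleR
          has_derivative_pf_eigenvalue isCont_perron_vec]])
  moreover have "(\<lambda>t. (N t - N s) *v perron_vec (N t)) differentiable (at s)"
    by (rule differentiableI[OF has_derivative_prod_vanishing[OF bounded_bilinear_matrix_vector_mult
          deriv isCont_perron_vec]])
  ultimately have "(\<lambda>t. (pf_eigenvalue (N t) - pf_eigenvalue (N s)) *\<^sub>R perron_vec (N t)
      - (N t - N s) *v perron_vec (N t)) differentiable (at s)"
    by (rule differentiable_diff)
  then obtain D where "((\<lambda>t. (pf_eigenvalue (N t) - pf_eigenvalue (N s)) *\<^sub>R perron_vec (N t)
      - (N t - N s) *v perron_vec (N t)) has_derivative D) (at s)"
    unfolding differentiable_def by blast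
  from bounded_linear.has_derivative[OF R this]
  have "((\<lambda>t. perron_vec (N t) - perron_vec (N s)) has_derivative (\<lambda>d. R (D d))) (at s)"
    unfolding eq[OF prim] .
  from has_derivative_add[OF this has_derivative_const[of "perron_vec (N s)"]]
  show ?thesis by (auto intro: differentiableI)
qed

end

section \<open>Gradient and Hessian of the logarithm of the tilted Perron eigenvalue\<close>

lemma gradient_eqI:
  assumes "GDERIV f x :> D"
  shows "gradient f x = D"
  unfolding gradient_def
proof (rule the_equality)
  fix E assume "GDERIV f x :> E"
  then have "(\<lambda>h. h \<bullet> E) = (\<lambda>h. h \<bullet> D)"
    using assms unfolding gderiv_def by (rule has_derivative_unique)
  then have "(E - D) \<bullet> E = (E - D) \<bullet> D" by metis
  then have "(E - D) \<bullet> (E - D) = 0" by (simp add: inner_diff_right)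
  then show "E = D" by simp
qed (rule assms)

text \<open>For positive \<open>c\<close>, this transfers strict positivity of a power of
  \<open>S\<close> to \<open>T\<close>. Nonnegativity is carried along because the induction
  multiplies inequalities.\<close>

lemma mat_pow_scaled_mono:
  fixes S T :: "real^'m^'m"
  assumes c: "0 \<le> c" and S: "\<And>i j. 0 \<le> S $ i $ j" and le: "\<And>i j. c * S $ i $ j \<le> T $ i $ j"
  shows "0 \<le> mat_pow S k $ i $ j \<and> c ^ k * mat_pow S k $ i $ j \<le> mat_pow T k $ i $ j"
proof (induction k arbitrary: i j)
  case 0
  then show ?case by (simp add: mat_pow_0 mat_def)
next
  case (Suc k)
  have T: "0 \<le> T $ i $ j" for i j using le[of i j] mult_nonneg_nonneg[OF c S[of i j]] by simp
  have "c ^ Suc k * (\<Sum>l\<in>UNIV. S $ i $ l * mat_pow S k $ l $ j)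
      = (\<Sum>l\<in>UNIV. (c * S $ i $ l) * (c ^ k * mat_pow S k $ l $ j))"
    by (simp add: sum_distrib_left mult_ac)
  also have "\<dots> \<le> (\<Sum>l\<in>UNIV. T $ i $ l * mat_pow T k $ l $ j)"
    using Suc le T c by (intro sum_mono mult_mono) auto
  finally show ?case
    using S Suc by (auto simp: mat_pow_Suc matrix_matrix_mult_def intro!: sum_nonneg)
qed

lemma tilted_matrix_component:
  "tilted_matrix A B t $ i $ j = (\<Sum>l\<in>UNIV. exp (t $ l) * A l $ i $ j) + B $ i $ j"
  by (simp add: tilted_matrix_def sum_component)

lemma tilted_matrix_0: "tilted_matrix A B 0 = total_matrix A B"
  by (simp add: tilted_matrix_def total_matrix_def)

section \<open>The exponentially tilted family\<close>

locale primitive_family =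
  fixes A :: "'l::finite \<Rightarrow> real^'m^'m" and B :: "real^'m^'m"
  assumes A_nonneg: "\<And>l i j. 0 \<le> A l $ i $ j" and B_nonneg: "\<And>i j. 0 \<le> B $ i $ j"
    and total_primitive: "primitive_matrix (total_matrix A B)"
begin

abbreviation "M \<equiv> tilted_matrix A B"
abbreviation "y t \<equiv> pf_eigenvalue (M t)"
abbreviation "v t \<equiv> perron_vec (M t)"
abbreviation "u t \<equiv> perron_vec (transpose (M t))"

lemma tilted_nonneg: "0 \<le> M t $ i $ j"
  unfolding tilted_matrix_component using A_nonneg B_nonneg by (intro add_nonneg_nonneg sum_nonneg) auto

lemma tilted_primitive: "primitive_matrix (M t)"
proof -
  \<comment> \<open>The 1 in the minimum accounts for \<open>B\<close>, which is not tilted.\<close>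
  define c where "c = Min (insert 1 (range (\<lambda>l. exp (t $ l))))"
  have c: "0 < c" unfolding c_def by (subst Min_gr_iff) auto
  have c1: "c \<le> 1" unfolding c_def by (intro Min_le) auto
  have ct: "c \<le> exp (t $ l)" for l unfolding c_def by (intro Min_le) auto
  have le: "c * M 0 $ i $ j \<le> M t $ i $ j" for i j
  proof -
    have "c * M 0 $ i $ j = (\<Sum>l\<in>UNIV. c * A l $ i $ j) + c * B $ i $ j"
      by (simp add: tilted_matrix_component distrib_left sum_distrib_left)
    also have "\<dots> \<le> (\<Sum>l\<in>UNIV. exp (t $ l) * A l $ i $ j) + 1 * B $ i $ j"
      using A_nonneg B_nonneg ct c1 by (intro add_mono sum_mono mult_right_mono) auto
    finally show ?thesis by (simp add: tilted_matrix_component)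
  qed
  obtain k where k: "k \<ge> 1" "\<And>i j. 0 < mat_pow (M 0) k $ i $ j"
    using total_primitive unfolding primitive_matrix_def tilted_matrix_0 by blast
  have "0 < mat_pow (M t) k $ i $ j" for i j
  proof -
    have "c ^ k * mat_pow (M 0) k $ i $ j \<le> mat_pow (M t) k $ i $ j"
      using mat_pow_scaled_mono[of c "M 0" "M t"] c tilted_nonneg le by (auto intro: less_imp_le)
    moreover have "0 < c ^ k * mat_pow (M 0) k $ i $ j" using c k(2) by simp
    ultimately show ?thesis by linarith
  qed
  then show ?thesis using k(1) tilted_nonneg unfolding primitive_matrix_def by blast
qed

definition M' :: "real^'l \<Rightarrow> real^'l \<Rightarrow> real^'m^'m" where
  "M' s d = (\<Sum>l\<in>UNIV. (exp (s $ l) * d $ l) *\<^sub>R A l)"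

lemma has_derivative_tilted: "(M has_derivative M' s) (at s)"
proof -
  have "((\<lambda>t. exp (t $ l)) has_derivative (\<lambda>d. exp (s $ l) * d $ l)) (at s)" for l :: 'l
  proof -
    have "((\<lambda>t::real^'l. t $ l) has_derivative (\<lambda>d. d $ l)) (at s)"
      by (rule bounded_linear_imp_has_derivative[OF bounded_linear_vec_nth])
    from has_derivative_compose[OF this, of exp "(*) (exp (s $ l))"]
    show ?thesis using DERIV_exp[of "s $ l"] unfolding has_field_derivative_def by simp
  qed
  then have "((\<lambda>t. (\<Sum>l\<in>UNIV. exp (t $ l) *\<^sub>R A l) + B) has_derivative
      (\<lambda>d. (\<Sum>l\<in>UNIV. (exp (s $ l) * d $ l) *\<^sub>R A l) + 0)) (at s)"
    by (intro has_derivative_add has_derivative_sum has_derivative_const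
        bounded_linear.has_derivative[OF bounded_linear_scaleR_left])
  then show ?thesis unfolding tilted_matrix_def[abs_def] M'_def[abs_def] by simp
qed

lemma bounded_linear_transpose: "bounded_linear (transpose :: real^'m^'m \<Rightarrow> real^'m^'m)"
  by (intro linear_conv_bounded_linear[THEN iffD1] linearI) (simp_all add: transpose_def vec_eq_iff)

lemma right_family: "differentiable_primitive M s (M' s)"
  by unfold_locales (rule tilted_primitive has_derivative_tilted)+

lemma left_family: "differentiable_primitive (\<lambda>t. transpose (M t)) s (\<lambda>d. transpose (M' s d))"
  by unfold_locales (rule primitive_matrix_transpose tilted_primitive
      bounded_linear.has_derivative[OF bounded_linear_transpose] has_derivative_tilted)+

text \<open>First-order perturbation: the partial derivative of \<open>M\<close> in direction
  \<open>l\<close> is \<open>exp (s $ l) *\<^sub>R A l\<close>, paired here with the left and right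
  Perron vectors.\<close>

definition G :: "real^'l \<Rightarrow> real^'l" where
  "G s = (\<chi> l. exp (s $ l) * (u s \<bullet> (A l *v v s)) / (u s \<bullet> v s))"

lemma GDERIV_y: "GDERIV y s :> G s"
proof -
  have "(u s \<bullet> (M' s d *v v s)) / (u s \<bullet> v s) = d \<bullet> G s" for d
  proof -
    have "M' s d *v x = (\<Sum>l\<in>UNIV. (exp (s $ l) * d $ l) *\<^sub>R (A l *v x))" for x
      unfolding M'_def
      by (simp add: linear_sum[OF bounded_linear.linear[OF bounded_bilinear.bounded_linear_left[OF bounded_bilinear_matrix_vector_mult]]]
          scaleR_matrix_vector_assoc)
    then have "(u s \<bullet> (M' s d *v v s)) / (u s \<bullet> v s)
        = (\<Sum>l\<in>UNIV. d $ l * (exp (s $ l) * (u s \<bullet> (A l *v v s)) / (u s \<bullet> v s)))"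
      by (simp add: inner_sum_right sum_divide_distrib mult_ac)
    also have "\<dots> = d \<bullet> G s" unfolding inner_vec_def[of d "G s"] by (simp add: G_def)
    finally show ?thesis .
  qed
  then show ?thesis
    using differentiable_primitive.has_derivative_pf_eigenvalue[OF right_family, of s]
    unfolding gderiv_def by simp
qed

lemma y_pos: "0 < y s"
  by (rule perron_frobenius(1)[OF tilted_primitive])

lemma GDERIV_ln_y: "GDERIV (\<lambda>t. ln (y t)) s :> (1 / y s) *\<^sub>R G s"
proof (rule GDERIV_DERIV_compose[OF GDERIV_y])
  show "(ln has_real_derivative 1 / y s) (at (y s))"
    using y_pos[of s] by (auto intro!: derivative_eq_intros)
qed

text \<open>The second differentiation acts on the closed form \<open>G\<close>, assembled from
  exponentials and the differentiable Perron vectors; its denominator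
  \<open>u s \<bullet> v s\<close> is positive.\<close>

lemma differentiable_gradient_ln_y: "gradient (\<lambda>t. ln (y t)) differentiable (at s)"
proof -
  have "gradient (\<lambda>t. ln (y t)) = (\<lambda>s. (1 / y s) *\<^sub>R G s)"
    using GDERIV_ln_y by (auto intro: gradient_eqI)
  moreover have y: "y differentiable (at s)"
    using GDERIV_y unfolding gderiv_def by (rule differentiableI)
  have v: "v differentiable (at s)"
    by (rule differentiable_primitive.differentiable_perron_vec[OF right_family])
  have u: "u differentiable (at s)"
    by (rule differentiable_primitive.differentiable_perron_vec[OF left_family])
  have uv: "u s \<bullet> v s \<noteq> 0"
    using inner_perron_vec_pos[OF tilted_primitive tilted_primitive] by (metis less_irrefl)
  have inner_diff: "(\<lambda>t. f t \<bullet> g t) differentiable (at s)"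
    if "f differentiable (at s)" "g differentiable (at s)" for f g :: "real^'l \<Rightarrow> real^'m"
    using that unfolding differentiable_def by (blast intro: has_derivative_inner)
  have "(\<lambda>t. A l *v v t) differentiable (at s)" for l
  proof -
    obtain D where "(v has_derivative D) (at s)" using v unfolding differentiable_def by blast
    then show ?thesis
      by (rule differentiableI[OF bounded_linear.has_derivative[OF matrix_vector_mul_bounded_linear]])
  qed
  then have num: "(\<lambda>t. u t \<bullet> (A l *v v t)) differentiable (at s)" for l
    using u by (intro inner_diff)
  have "(\<lambda>t::real^'l. t $ l) differentiable (at s)" for l
    by (rule differentiableI[OF bounded_linear_imp_has_derivative[OF bounded_linear_vec_nth]])
  then have e: "(\<lambda>t::real^'l. exp (t $ l)) differentiable (at s)" for l
    by (rule differentiable_compose[rotated]) (auto intro: field_differentiable_imp_differentiable simp: field_differentiable_within_exp)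
  have "(\<lambda>t. exp (t $ l) * (u t \<bullet> (A l *v v t)) / (u t \<bullet> v t)) differentiable (at s)" for l
    using uv by (intro differentiable_divide differentiable_mult e num inner_diff u v)
  then have "G differentiable (at s)"
    unfolding differentiable_componentwise_within[of G] Basis_vec_def
    by (auto simp: G_def inner_axis)
  moreover have "(\<lambda>t. 1 / y t) differentiable (at s)"
    using y y_pos[of s] by (intro differentiable_divide) auto
  ultimately show ?thesis by (simp add: differentiable_scaleR)
qed

text \<open>\<open>hessian\<close> is a Jacobian, which represents the derivative once
  differentiability is known.\<close>

lemma has_derivative_gradient_ln_y:
  "(gradient (\<lambda>t. ln (y t)) has_derivative (\<lambda>h. hessian (\<lambda>t. ln (y t)) s *v h)) (at s)"
  using differentiable_gradient_ln_y unfolding hessian_def by (subst (asm) jacobian_works)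

lemma gradient_y: "gradient y s = G s"
  by (rule gradient_eqI[OF GDERIV_y])

lemma gradient_ln_y: "gradient (\<lambda>t. ln (y t)) s = (1 / y s) *\<^sub>R G s"
  by (rule gradient_eqI[OF GDERIV_ln_y])

end

text \<open>One application of l'Hopital's rule turns the quotient into half of a difference
  quotient of \<open>t \<bullet> g (r *\<^sub>R t)\<close> at \<open>r = 0\<close>, whose limit is
  given by the derivative of \<open>g\<close> at the origin.\<close>

lemma second_order_expansion:
  fixes f :: "'a::real_inner \<Rightarrow> real"
  assumes f: "\<And>x. GDERIV f x :> g x" and g: "(g has_derivative H) (at 0)"
  shows "((\<lambda>r. (f (r *\<^sub>R t) - f 0 - r * (t \<bullet> g 0)) / r\<^sup>2) \<longlongrightarrow> (t \<bullet> H t) / 2) (at (0::real))"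
proof (rule lhopital)
  have lin: "((\<lambda>r. r *\<^sub>R t) has_derivative (\<lambda>d. d *\<^sub>R t)) (at r)" for r :: real
    by (rule bounded_linear_imp_has_derivative[OF bounded_linear_scaleR_left])
  have df: "((\<lambda>r. f (r *\<^sub>R t)) has_real_derivative (t \<bullet> g (r *\<^sub>R t))) (at r)" for r
  proof -
    have "((\<lambda>r. f (r *\<^sub>R t)) has_derivative (\<lambda>d. (d *\<^sub>R t) \<bullet> g (r *\<^sub>R t))) (at r)"
      by (rule has_derivative_compose[OF lin f[unfolded gderiv_def]])
    then show ?thesis unfolding has_field_derivative_def by (simp add: mult_commute_abs)
  qed
  have "((\<lambda>r. f (r *\<^sub>R t)) \<longlongrightarrow> f (0 *\<^sub>R t)) (at 0)"
    using DERIV_isCont[OF df[of 0]] unfolding isCont_def .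
  then have "((\<lambda>r. f (r *\<^sub>R t) - f 0 - r * (t \<bullet> g 0)) \<longlongrightarrow> f (0 *\<^sub>R t) - f 0 - 0 * (t \<bullet> g 0)) (at 0)"
    by (intro tendsto_intros)
  then show "((\<lambda>r. f (r *\<^sub>R t) - f 0 - r * (t \<bullet> g 0)) \<longlongrightarrow> 0) (at 0)" by simp
  show "((\<lambda>r::real. r\<^sup>2) \<longlongrightarrow> 0) (at 0)" by real_asymp
  show "\<forall>\<^sub>F r::real in at 0. r\<^sup>2 \<noteq> 0" by (auto simp: eventually_at_filter)
  show "\<forall>\<^sub>F r::real in at 0. 2 * r \<noteq> 0" by (auto simp: eventually_at_filter)
  show "\<forall>\<^sub>F r in at 0. ((\<lambda>r. f (r *\<^sub>R t) - f 0 - r * (t \<bullet> g 0)) has_real_derivative t \<bullet> g (r *\<^sub>R t) - t \<bullet> g 0) (at r)"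
    by (intro always_eventually allI) (auto intro!: derivative_eq_intros df)
  show "\<forall>\<^sub>F r in at 0. ((\<lambda>r. r\<^sup>2) has_real_derivative 2 * r) (at r)"
    by (intro always_eventually allI) (auto intro!: derivative_eq_intros)
  interpret H: bounded_linear H by (rule has_derivative_bounded_linear[OF g])
  have "((\<lambda>r. t \<bullet> g (r *\<^sub>R t)) has_derivative (\<lambda>d. t \<bullet> H (d *\<^sub>R t))) (at 0)"
  proof (rule has_derivative_inner_right[OF has_derivative_compose[OF lin]])
    show "(g has_derivative H) (at (0 *\<^sub>R t))" using g by simp
  qed
  then have "((\<lambda>r. t \<bullet> g (r *\<^sub>R t)) has_real_derivative (t \<bullet> H t)) (at 0)"
    unfolding has_field_derivative_def by (simp add: H.scaleR mult_commute_abs)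
  then have "((\<lambda>r. (t \<bullet> g (r *\<^sub>R t) - t \<bullet> g 0) / r) \<longlongrightarrow> t \<bullet> H t) (at 0)"
    by (simp add: DERIV_def)
  then have "((\<lambda>r. (t \<bullet> g (r *\<^sub>R t) - t \<bullet> g 0) / r / 2) \<longlongrightarrow> (t \<bullet> H t) / 2) (at 0)"
    by (rule tendsto_divide) auto
  then show "((\<lambda>r. (t \<bullet> g (r *\<^sub>R t) - t \<bullet> g 0) / (2 * r)) \<longlongrightarrow> (t \<bullet> H t) / 2) (at 0)"
    by (simp add: mult.commute)
qed

section \<open>Exponential moments of the symbol statistics\<close>

lemma exp_inner_symbol_statistics_Cons:
  fixes t :: "real^'l::finite"
  shows "exp (t \<bullet> symbol_statistics (x # w)) =
    (case x of Some i \<Rightarrow> exp (t $ i) | None \<Rightarrow> 1) * exp (t \<bullet> symbol_statistics w)"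
proof -
  have "symbol_statistics (x # w) = (case x of Some i \<Rightarrow> axis i 1 | None \<Rightarrow> 0) + (symbol_statistics w :: real^'l)"
    by (auto simp: symbol_statistics_def vec_eq_iff axis_def split: option.split)
  then show ?thesis
    by (auto simp: inner_add_right exp_add inner_axis split: option.split)
qed

lemma sum_words_Suc:
  fixes f :: "'l::finite option list \<Rightarrow> 'b::comm_monoid_add"
  shows "(\<Sum>w | length w = Suc n. f w) = (\<Sum>x\<in>UNIV. \<Sum>w | length w = n. f (x # w))"
proof -
  have "(\<Sum>w | length w = Suc n. f w) = (\<Sum>p\<in>UNIV \<times> {w. length w = n}. f (fst p # snd p))"
    by (rule sum.reindex_bij_witness[where i = "\<lambda>p. fst p # snd p" and j = "\<lambda>w. (hd w, tl w)"])
       (auto simp: length_Suc_conv)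
  then show ?thesis by (simp add: sum.cartesian_product split_beta)
qed

lemma sum_UNIV_option:
  fixes f :: "'l::finite option \<Rightarrow> 'b::comm_monoid_add"
  shows "(\<Sum>x\<in>UNIV. f x) = (\<Sum>i\<in>UNIV. f (Some i)) + f None"
  by (simp add: UNIV_option_conv sum.reindex add.commute)

lemma finite_words: "finite {w :: 'l::finite option list. length w = n}"
  using finite_lists_length_eq[of "UNIV :: 'l option set" n] by simp

lemma matrix_vector_mult_sum_right: "T *v (\<Sum>i\<in>I. f i) = (\<Sum>i\<in>I. T *v f i)" for T :: "real^'m^'m"
  by (rule linear_sum) (rule bounded_linear.linear[OF matrix_vector_mul_bounded_linear])

lemma matrix_vector_mult_sum_left: "(\<Sum>i\<in>I. F i) *v x = (\<Sum>i\<in>I. F i *v x)"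
  for x :: "real^'m" and F :: "'i \<Rightarrow> real^'m^'m"
  by (rule linear_sum[OF bounded_linear.linear])
     (rule bounded_bilinear.bounded_linear_left[OF bounded_bilinear_matrix_vector_mult])

text \<open>The exponential weight is multiplicative over letters, so \<open>Some i\<close>
  contributes \<open>exp (t $ i) *\<^sub>R A i\<close> and \<open>None\<close> contributes
  \<open>B\<close>; summing over the first letter produces one factor of the tilted matrix.\<close>

lemma sum_words_tilted:
  fixes t :: "real^'l::finite" and \<eta> :: "real^'m"
  shows "(\<Sum>w | length w = n. exp (t \<bullet> symbol_statistics w) *\<^sub>R (mu A B w *v \<eta>))
           = mat_pow (tilted_matrix A B t) n *v \<eta>"
proof (induction n)
  case 0
  have "t \<bullet> symbol_statistics [] = 0" by (simp add: symbol_statistics_def inner_vec_def)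
  then show ?case by (simp add: mat_pow_0)
next
  case (Suc n)
  define c where "c x = (case x of Some i \<Rightarrow> exp (t $ i) | None \<Rightarrow> 1)" for x
  define D where "D x = (case x of Some i \<Rightarrow> A i | None \<Rightarrow> B)" for x
  have "(\<Sum>w | length w = Suc n. exp (t \<bullet> symbol_statistics w) *\<^sub>R (mu A B w *v \<eta>))
      = (\<Sum>x\<in>UNIV. \<Sum>w | length w = n. (c x *\<^sub>R D x) *v (exp (t \<bullet> symbol_statistics w) *\<^sub>R (mu A B w *v \<eta>)))"
    unfolding sum_words_Suc exp_inner_symbol_statistics_Cons c_def[symmetric]
    by (simp add: D_def[symmetric] matrix_vector_mult_scaleR mult.commute flip: matrix_vector_mul_assoc scaleR_matrix_vector_assoc)
  also have "\<dots> = (\<Sum>x\<in>UNIV. c x *\<^sub>R D x) *v (mat_pow (tilted_matrix A B t) n *v \<eta>)"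
    by (simp add: matrix_vector_mult_sum_left flip: Suc matrix_vector_mult_sum_right)
  also have "(\<Sum>x\<in>UNIV. c x *\<^sub>R D x) = tilted_matrix A B t"
    by (simp add: sum_UNIV_option c_def D_def tilted_matrix_def)
  finally show ?case by (simp add: mat_pow_mult_vec_Suc)
qed

section \<open>Growth of the weighted word sums\<close>

locale primitive_representation = primitive_family A B
  for A :: "'l::finite \<Rightarrow> real^'m^'m" and B :: "real^'m^'m" +
  fixes \<xi> \<eta> :: "real^'m"
  assumes \<xi>_nonneg: "\<And>j. 0 \<le> \<xi> $ j" and \<eta>_nonneg: "\<And>j. 0 \<le> \<eta> $ j"
    and \<xi>_nonzero: "\<xi> \<noteq> 0" and \<eta>_nonzero: "\<eta> \<noteq> 0"
begin

text \<open>The unnormalised moment generating function of the symbol statistics; at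
  \<open>t = 0\<close> it is the normalising constant of \<open>word_measure\<close>.\<close>

definition W :: "nat \<Rightarrow> real^'l \<Rightarrow> real" where
  "W n t = \<xi> \<bullet> (mat_pow (M t) n *v \<eta>)"

lemma sum_words_weight:
  "(\<Sum>w | length w = n. exp (t \<bullet> symbol_statistics w) * word_weight \<xi> A B \<eta> w) = W n t"
  unfolding W_def sum_words_tilted[symmetric] by (simp add: word_weight_def inner_sum_right)

lemma isCont_mat_pow_tilted: "isCont (\<lambda>t. mat_pow (M t) k *v \<eta>) s"
proof (induction k)
  case (Suc k)
  then show ?case
    unfolding mat_pow_mult_vec_Suc
    using bounded_bilinear.isCont[OF bounded_bilinear_matrix_vector_mult
        differentiable_primitive.isCont_N[OF right_family]] by blast
qed (simp add: mat_pow_0)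

text \<open>Lets a coordinatewise comparison with multiples of the Perron vector pass through the
  remaining matrix powers.\<close>

lemma inner_mat_pow_mono:
  assumes "\<And>i. x $ i \<le> x' $ i"
  shows "\<xi> \<bullet> (mat_pow (M t) n *v x) \<le> \<xi> \<bullet> (mat_pow (M t) n *v x')"
proof -
  have "0 \<le> (mat_pow (M t) n *v (x' - x)) $ i" for i
    using assms by (intro mat_pow_mult_vec_nonneg tilted_nonneg) simp
  then have "0 \<le> \<xi> \<bullet> (mat_pow (M t) n *v (x' - x))"
    using \<xi>_nonneg by (auto simp: inner_vec_def intro!: sum_nonneg)
  then show ?thesis by (simp add: matrix_vector_mult_diff_distrib inner_diff_right)
qed

text \<open>After \<open>k\<close> steps \<open>\<eta>\<close> has become a positive vector, comparable to the Perron eigenvector.\<close>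

lemma eventually_W_bounds:
  fixes s :: "nat \<Rightarrow> real^'l"
  assumes s: "s \<longlonglongrightarrow> 0"
  shows "\<exists>c C. 0 < c \<and> (\<forall>\<^sub>F n in sequentially. c * y (s n) ^ n \<le> W n (s n) \<and> W n (s n) \<le> C * y (s n) ^ n)"
proof -
  obtain k where k: "k \<ge> 1" "\<And>i j. 0 < mat_pow (M 0) k $ i $ j"
    using tilted_primitive[of 0] unfolding primitive_matrix_def by blast
  define f where "f t = mat_pow (M t) k *v \<eta>" for t
  have f0: "0 < f 0 $ i" for i
    unfolding f_def using k(2) \<eta>_nonneg \<eta>_nonzero by (rule positive_matrix_vector_mult)
  have v_pos: "0 < v t $ i" for t i by (rule perron_vec(1)[OF tilted_primitive])
  have f_lim: "(\<lambda>n. f (s n)) \<longlonglongrightarrow> f 0"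
    unfolding f_def using isCont_mat_pow_tilted s by (rule isCont_tendsto_compose)
  have v_lim: "(\<lambda>n. v (s n)) \<longlonglongrightarrow> v 0"
    using differentiable_primitive.isCont_perron_vec[OF right_family] s by (rule isCont_tendsto_compose)
  have y_lim: "(\<lambda>n. y (s n)) \<longlonglongrightarrow> y 0"
    using differentiable_primitive.isCont_pf_eigenvalue[OF right_family] s by (rule isCont_tendsto_compose)
  define q where "q i = f 0 $ i / v 0 $ i" for i
  have q: "0 < q i" for i using f0 v_pos by (simp add: q_def)
  have q_lim: "(\<lambda>n. f (s n) $ i / v (s n) $ i) \<longlonglongrightarrow> q i" for i
    unfolding q_def using v_pos[of 0 i]
    by (intro tendsto_divide tendsto_vec_nth f_lim v_lim) simp
  \<comment> \<open>Half the smallest limiting ratio, and below one more than the largest: the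
    strict gaps make the bounds hold eventually along \<open>s\<close>.\<close>
  define c where "c = Min (range q) / 2"
  have c: "0 < c" using q by (simp add: c_def)
  have c_less: "c < q i" for i
  proof -
    have "Min (range q) \<le> q i" by (intro Min_le) auto
    then have "2 * c \<le> q i" by (simp only: c_def)
    then show ?thesis using c by linarith
  qed
  define C where "C = Max (range q) + 1"
  have less_C: "q i < C" for i
  proof -
    have "q i \<le> Max (range q)" by (intro Max_ge) auto
    then show ?thesis unfolding C_def by linarith
  qed
  \<comment> \<open>Splitting off \<open>k\<close> factors leaves \<open>y (s n) ^ (n - k)\<close>,
    which is \<open>y (s n) ^ n\<close> divided by \<open>y (s n) ^ k\<close>; the quotient with
    \<open>\<xi> \<bullet> v (s n)\<close> converges to \<open>g\<close>.\<close>
  define g where "g = (\<xi> \<bullet> v 0) / y 0 ^ k"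
  have g: "0 < g"
    using inner_pos_vec[of "v 0" \<xi>] v_pos \<xi>_nonneg \<xi>_nonzero y_pos[of 0] by (simp add: g_def inner_commute)
  have g_lim: "(\<lambda>n. (\<xi> \<bullet> v (s n)) / y (s n) ^ k) \<longlonglongrightarrow> g"
    unfolding g_def using y_pos[of 0] by (intro tendsto_intros v_lim y_lim) simp
  have "\<forall>\<^sub>F n in sequentially. \<forall>i. c < f (s n) $ i / v (s n) $ i \<and> f (s n) $ i / v (s n) $ i < C"
    using order_tendstoD[OF q_lim] c_less less_C by (intro eventually_all_finite eventually_conj) auto
  moreover have "\<forall>\<^sub>F n in sequentially. g / 2 < (\<xi> \<bullet> v (s n)) / y (s n) ^ k"
    using order_tendstoD(1)[OF g_lim, of "g / 2"] g by simp
  moreover have "\<forall>\<^sub>F n in sequentially. (\<xi> \<bullet> v (s n)) / y (s n) ^ k < 2 * g"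
    using order_tendstoD(2)[OF g_lim, of "2 * g"] g by simp
  ultimately have "\<forall>\<^sub>F n in sequentially. c * (g / 2) * y (s n) ^ n \<le> W n (s n) \<and> W n (s n) \<le> C * (2 * g) * y (s n) ^ n"
    using eventually_ge_at_top[of k]
  proof eventually_elim
    case (elim n)
    have yn: "0 < y (s n)" by (rule y_pos)
    have split: "W n (s n) = \<xi> \<bullet> (mat_pow (M (s n)) (n - k) *v f (s n))"
      using elim unfolding W_def f_def by (simp flip: mat_pow_add_mult_vec)
    have pow: "\<xi> \<bullet> (mat_pow (M (s n)) (n - k) *v (d *\<^sub>R v (s n))) = d * ((\<xi> \<bullet> v (s n)) / y (s n) ^ k) * y (s n) ^ n" for d
    proof -
      have "mat_pow (M (s n)) (n - k) *v v (s n) = y (s n) ^ (n - k) *\<^sub>R v (s n)"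
        by (rule mat_pow_eigenvector[OF perron_frobenius(2)[OF tilted_primitive]])
      moreover have "y (s n) ^ n = y (s n) ^ (n - k) * y (s n) ^ k"
        using elim by (simp flip: power_add)
      ultimately show ?thesis using yn by (simp add: matrix_vector_mult_scaleR)
    qed
    have c_le: "c * v (s n) $ i \<le> f (s n) $ i" and le_C: "f (s n) $ i \<le> C * v (s n) $ i" for i
      using elim(1) v_pos[of "s n" i] by (auto simp: field_simps dest!: spec[of _ i] intro: less_imp_le)
    have C0: "0 < C" using q less_C less_trans by blast
    have "c * (g / 2) * y (s n) ^ n \<le> c * ((\<xi> \<bullet> v (s n)) / y (s n) ^ k) * y (s n) ^ n"
      using elim c yn by (intro mult_right_mono mult_left_mono) auto
    also have "\<dots> \<le> W n (s n)"
      unfolding split pow[symmetric] using c_le by (intro inner_mat_pow_mono) simp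
    finally have "c * (g / 2) * y (s n) ^ n \<le> W n (s n)" .
    moreover have "W n (s n) \<le> C * ((\<xi> \<bullet> v (s n)) / y (s n) ^ k) * y (s n) ^ n"
      unfolding split pow[symmetric] using le_C by (intro inner_mat_pow_mono) simp
    moreover have "\<dots> \<le> C * (2 * g) * y (s n) ^ n"
      using elim C0 yn by (intro mult_right_mono mult_left_mono) auto
    ultimately show ?case by simp
  qed
  then show ?thesis using c g by (intro exI[of _ "c * (g / 2)"] exI[of _ "C * (2 * g)"]) simp
qed

text \<open>The multiplicative bounds become an additive error that stays bounded, which the factor
  \<open>a n\<close> later sends to 0.\<close>

lemma eventually_ln_W:
  fixes s :: "nat \<Rightarrow> real^'l"
  assumes s: "s \<longlonglongrightarrow> 0"
  shows "\<exists>K. \<forall>\<^sub>F n in sequentially. 0 < W n (s n) \<and> \<bar>ln (W n (s n)) - real n * ln (y (s n))\<bar> \<le> K"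
proof -
  obtain c C where c: "0 < c"
    and ev: "\<forall>\<^sub>F n in sequentially. c * y (s n) ^ n \<le> W n (s n) \<and> W n (s n) \<le> C * y (s n) ^ n"
    using eventually_W_bounds[OF s] by blast
  have "\<forall>\<^sub>F n in sequentially. 0 < W n (s n) \<and> \<bar>ln (W n (s n)) - real n * ln (y (s n))\<bar> \<le> \<bar>ln c\<bar> + \<bar>ln C\<bar>"
    using ev
  proof eventually_elim
    case (elim n)
    have yn: "0 < y (s n) ^ n" using y_pos by simp
    then have cy: "0 < c * y (s n) ^ n" using c by simp
    then have W: "0 < W n (s n)" using elim by linarith
    then have "0 < C * y (s n) ^ n" using elim by linarith
    then have C: "0 < C" using yn by (rule zero_less_mult_pos2)
    have "ln (c * y (s n) ^ n) \<le> ln (W n (s n))" "ln (W n (s n)) \<le> ln (C * y (s n) ^ n)"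
      using elim cy W by (auto intro!: ln_mono)
    then show ?case using W c C y_pos[of "s n"] by (simp add: ln_mult ln_realpow)
  qed
  then show ?thesis by blast
qed

lemma eventually_W0_pos: "\<forall>\<^sub>F n in sequentially. 0 < W n 0"
  using eventually_ln_W[of "\<lambda>_. 0"] by (auto elim: eventually_mono)

section \<open>The word measure as a finite probability space\<close>

lemma word_weight_nonneg: "0 \<le> word_weight \<xi> A B \<eta> w"
proof -
  have "0 \<le> mu A B w $ i $ j" for i j
    by (induction w arbitrary: i j)
       (auto simp: mat_def matrix_matrix_mult_def A_nonneg B_nonneg intro!: sum_nonneg split: option.split)
  then have "0 \<le> (mu A B w *v \<eta>) $ i" for i
    using \<eta>_nonneg by (rule matrix_vector_mult_nonneg)
  then show ?thesis
    unfolding word_weight_def inner_vec_def using \<xi>_nonneg by (simp add: sum_nonneg)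
qed

lemma word_measure_eq:
  "word_measure \<xi> A B \<eta> n = point_measure {w. length w = n} (\<lambda>w. ennreal (word_weight \<xi> A B \<eta> w / W n 0))"
  unfolding word_measure_def W_def tilted_matrix_0 ..

lemma prob_space_word_measure:
  assumes "0 < W n 0"
  shows "prob_space (word_measure \<xi> A B \<eta> n)"
proof
  have "emeasure (word_measure \<xi> A B \<eta> n) {w. length w = n}
      = (\<Sum>w | length w = n. ennreal (word_weight \<xi> A B \<eta> w / W n 0))"
    unfolding word_measure_eq by (rule emeasure_point_measure_finite[OF finite_words]) simp
  also have "\<dots> = ennreal (\<Sum>w | length w = n. word_weight \<xi> A B \<eta> w / W n 0)"
    using assms by (intro sum_ennreal) (simp add: word_weight_nonneg)
  also have "(\<Sum>w | length w = n. word_weight \<xi> A B \<eta> w / W n 0) = 1"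
    using sum_words_weight[of 0 n] assms by (simp flip: sum_divide_distrib)
  finally show "emeasure (word_measure \<xi> A B \<eta> n) (space (word_measure \<xi> A B \<eta> n)) = 1"
    by (simp add: word_measure_eq space_point_measure)
qed

lemma integrable_word_measure: "integrable (word_measure \<xi> A B \<eta> n) (f :: _ \<Rightarrow> real)"
  unfolding word_measure_eq by (intro integrable_point_measure_finite finite_words)

lemma borel_measurable_word_measure: "(f :: _ \<Rightarrow> 'b::topological_space) \<in> borel_measurable (word_measure \<xi> A B \<eta> n)"
  unfolding word_measure_eq by simp

lemma integral_exp_symbol_statistics:
  assumes "0 < W n 0"
  shows "(\<integral>w. exp (t \<bullet> symbol_statistics w) \<partial>word_measure \<xi> A B \<eta> n) = W n t / W n 0"
proof -
  have "(\<integral>w. exp (t \<bullet> symbol_statistics w) \<partial>word_measure \<xi> A B \<eta> n)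
      = (\<Sum>w | length w = n. (word_weight \<xi> A B \<eta> w / W n 0) * exp (t \<bullet> symbol_statistics w))"
    unfolding word_measure_eq
    using assms word_weight_nonneg
    by (subst lebesgue_integral_point_measure_finite[OF finite_words]) auto
  also have "\<dots> = (\<Sum>w | length w = n. exp (t \<bullet> symbol_statistics w) * word_weight \<xi> A B \<eta> w) / W n 0"
    by (simp add: sum_divide_distrib mult.commute)
  finally show ?thesis unfolding sum_words_weight .
qed

section \<open>Moderate deviation scaling\<close>

context
  fixes a :: "nat \<Rightarrow> real" and \<beta> :: "real^'l" and \<Gamma> :: "real^'l^'l"
  assumes a_pos: "\<And>n. 0 < a n" and a_lim: "a \<longlonglongrightarrow> 0"
    and na: "filterlim (\<lambda>n. real n * a n) at_top sequentially"
  defines "\<beta> \<equiv> gradient (\<lambda>t. ln (y t)) 0" and "\<Gamma> \<equiv> hessian (\<lambda>t. ln (y t)) 0"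
begin

definition X :: "nat \<Rightarrow> 'l option list \<Rightarrow> real^'l" where
  "X n w = (1 / sqrt (real n / a n)) *\<^sub>R (symbol_statistics w - real n *\<^sub>R \<beta>)"

definition r :: "nat \<Rightarrow> real" where
  "r n = 1 / sqrt (real n * a n)"

lemma r_lim: "r \<longlonglongrightarrow> 0"
  unfolding r_def
  by (intro tendsto_divide_0[OF tendsto_const] filterlim_at_top_imp_at_infinity
      filterlim_compose[OF sqrt_at_top na])

text \<open>The speed \<open>1 / a n\<close> and the normalisation by
  \<open>sqrt (real n / a n)\<close> combine into the small factor \<open>r n\<close>, so up to
  centring the exponential moments of \<open>X n\<close> are those of the symbol statistics near
  \<open>t = 0\<close>.\<close>

lemma inner_X: "(1 / a n) * (t \<bullet> X n w)
    = (r n *\<^sub>R t) \<bullet> symbol_statistics w - real n * (r n * (t \<bullet> \<beta>))"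
proof -
  have "(1 / a n) * (1 / sqrt (real n / a n)) = r n"
  proof -
    have "sqrt (real n * a n) = a n * sqrt (real n / a n)"
      using a_pos[of n] by (simp add: real_sqrt_divide real_sqrt_mult field_simps less_imp_le)
    then show ?thesis by (simp add: r_def)
  qed
  then have "(1 / a n) * (t \<bullet> X n w) = r n * (t \<bullet> (symbol_statistics w - real n *\<^sub>R \<beta>))"
    unfolding X_def inner_scaleR_right by (metis mult.assoc)
  then show ?thesis by (simp add: inner_diff_right algebra_simps)
qed

lemma integral_exp_X:
  assumes "0 < W n 0"
  shows "(\<integral>w. exp ((1 / a n) * (t \<bullet> X n w)) \<partial>word_measure \<xi> A B \<eta> n)
    = exp (- (real n * (r n * (t \<bullet> \<beta>)))) * (W n (r n *\<^sub>R t) / W n 0)"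
  unfolding inner_X exp_diff
  using integral_exp_symbol_statistics[OF assms, of "r n *\<^sub>R t"]
  by (simp add: exp_minus field_simps)

lemma scaled_cumulant_tendsto:
  "(\<lambda>n. a n * (ln (W n (r n *\<^sub>R t)) - ln (W n 0) - real n * (r n * (t \<bullet> \<beta>)))) \<longlonglongrightarrow> (t \<bullet> (\<Gamma> *v t)) / 2"
proof -
  let ?\<phi> = "\<lambda>t. ln (y t)"
  have "(\<lambda>n. r n *\<^sub>R t) \<longlonglongrightarrow> 0 *\<^sub>R t" by (intro tendsto_intros r_lim)
  then obtain K1 where K1: "\<forall>\<^sub>F n in sequentially. 0 < W n (r n *\<^sub>R t) \<and> \<bar>ln (W n (r n *\<^sub>R t)) - real n * ?\<phi> (r n *\<^sub>R t)\<bar> \<le> K1"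
    using eventually_ln_W[of "\<lambda>n. r n *\<^sub>R t"] by auto
  obtain K2 where K2: "\<forall>\<^sub>F n in sequentially. 0 < W n 0 \<and> \<bar>ln (W n 0) - real n * ?\<phi> 0\<bar> \<le> K2"
    using eventually_ln_W[of "\<lambda>n. 0"] by auto
  \<comment> \<open>The part not accounted for by the Perron eigenvalue; it stays bounded, so
    multiplication by \<open>a n\<close> sends it to 0.\<close>
  define E where "E n = ln (W n (r n *\<^sub>R t)) - ln (W n 0) - real n * (?\<phi> (r n *\<^sub>R t) - ?\<phi> 0)" for n
  have "(\<lambda>n. a n * E n) \<longlonglongrightarrow> 0"
  proof (rule Lim_null_comparison)
    show "\<forall>\<^sub>F n in sequentially. norm (a n * E n) \<le> a n * (K1 + K2)"
      using K1 K2
    proof eventually_elim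
      case (elim n)
      have "\<bar>E n\<bar> \<le> K1 + K2" using elim by (simp add: E_def right_diff_distrib abs_le_iff)
      then show ?case using a_pos[of n] by (simp add: abs_mult)
    qed
    show "(\<lambda>n. a n * (K1 + K2)) \<longlonglongrightarrow> 0" by (rule tendsto_mult_left_zero[OF a_lim])
  qed
  moreover have "(\<lambda>n. (?\<phi> (r n *\<^sub>R t) - ?\<phi> 0 - r n * (t \<bullet> \<beta>)) / (r n)\<^sup>2) \<longlonglongrightarrow> (t \<bullet> (\<Gamma> *v t)) / 2"
  proof -
    have "((\<lambda>r. (?\<phi> (r *\<^sub>R t) - ?\<phi> 0 - r * (t \<bullet> gradient ?\<phi> 0)) / r\<^sup>2) \<longlongrightarrow> (t \<bullet> (hessian ?\<phi> 0 *v t)) / 2) (at 0)"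
      using GDERIV_ln_y gradient_ln_y has_derivative_gradient_ln_y
      by (intro second_order_expansion[where g = "gradient ?\<phi>"]) auto
    \<comment> \<open>The expansion is a punctured limit, so \<open>r n\<close> must be nonzero; it
      is 0 only where \<open>real n * a n\<close> is 0.\<close>
    moreover have "filterlim r (at 0) sequentially"
    proof (rule filterlim_atI[OF r_lim])
      have "\<forall>\<^sub>F n in sequentially. 0 < real n * a n"
        using na unfolding filterlim_at_top_dense by blast
      then show "\<forall>\<^sub>F n in sequentially. r n \<noteq> 0"
        by eventually_elim (auto simp: r_def zero_less_mult_iff)
    qed
    ultimately show ?thesis unfolding \<beta>_def \<Gamma>_def by (rule filterlim_compose)
  qed
  ultimately have "(\<lambda>n. a n * E n + (?\<phi> (r n *\<^sub>R t) - ?\<phi> 0 - r n * (t \<bullet> \<beta>)) / (r n)\<^sup>2) \<longlonglongrightarrow> 0 + (t \<bullet> (\<Gamma> *v t)) / 2"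
    by (rule tendsto_add)
  moreover have "\<forall>\<^sub>F n in sequentially. a n * E n + (?\<phi> (r n *\<^sub>R t) - ?\<phi> 0 - r n * (t \<bullet> \<beta>)) / (r n)\<^sup>2
      = a n * (ln (W n (r n *\<^sub>R t)) - ln (W n 0) - real n * (r n * (t \<bullet> \<beta>)))"
    using eventually_gt_at_top[of 0]
  proof eventually_elim
    case (elim n)
    \<comment> \<open>Thus \<open>a n * real n\<close> is exactly \<open>1 / (r n)^2\<close>, the
      scale of the second-order expansion.\<close>
    have "(r n)\<^sup>2 = 1 / (real n * a n)" using a_pos[of n] elim by (simp add: r_def power_divide)
    then show ?case by (simp add: E_def algebra_simps)
  qed
  ultimately show ?thesis by (simp add: tendsto_cong)
qed

text \<open>\<open>\<Gamma>\<close> enters through its symmetric part, which has the same quadratic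
  form and satisfies the symmetry in the locale.\<close>

lemma quadratic_cumulants_word_measure:
  "quadratic_cumulants (word_measure \<xi> A B \<eta>) X (\<lambda>n. 1 / a n) (\<lambda>t. (1 / 2) *\<^sub>R ((\<Gamma> + transpose \<Gamma>) *v t))"
proof (rule quadratic_cumulants.intro)
  show "\<forall>\<^sub>F n in sequentially. prob_space (word_measure \<xi> A B \<eta> n)"
    using eventually_W0_pos by eventually_elim (rule prob_space_word_measure)
  show "\<forall>\<^sub>F n in sequentially. X n \<in> borel_measurable (word_measure \<xi> A B \<eta> n)"
    by (intro always_eventually allI borel_measurable_word_measure)
  show "\<forall>\<^sub>F n in sequentially. integrable (word_measure \<xi> A B \<eta> n) (\<lambda>w. exp (1 / a n * (t \<bullet> X n w)))" for t
    by (intro always_eventually allI integrable_word_measure)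
  show "0 < 1 / a n" for n using a_pos by simp
  show "filterlim (\<lambda>n. 1 / a n) at_top sequentially"
    using filterlim_inverse_at_top[OF a_lim] a_pos by (simp add: inverse_eq_divide)
  show "linear (\<lambda>t. (1 / 2) *\<^sub>R ((\<Gamma> + transpose \<Gamma>) *v t))"
    by (intro linear_compose_scale_right bounded_linear.linear[OF matrix_vector_mul_bounded_linear])
  have trans: "s \<bullet> (transpose \<Gamma> *v t) = (\<Gamma> *v s) \<bullet> t" for s t
    using inner_transpose_mult[of s "transpose \<Gamma>" t] by (simp only: transpose_transpose)
  have trans': "s \<bullet> (\<Gamma> *v t) = (transpose \<Gamma> *v s) \<bullet> t" for s t
    by (rule inner_transpose_mult)
  show "s \<bullet> ((1 / 2) *\<^sub>R ((\<Gamma> + transpose \<Gamma>) *v t)) = ((1 / 2) *\<^sub>R ((\<Gamma> + transpose \<Gamma>) *v s)) \<bullet> t" for s t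
    using trans[of s t] trans'[of s t]
    by (simp add: matrix_vector_mult_add_rdistrib inner_add_left inner_add_right del: transpose_matrix_vector)
  fix t :: "real^'l" and \<epsilon> :: real assume \<epsilon>: "0 < \<epsilon>"
  define L where "L n = a n * (ln (W n (r n *\<^sub>R t)) - ln (W n 0) - real n * (r n * (t \<bullet> \<beta>)))" for n
  have half: "t \<bullet> ((1 / 2) *\<^sub>R ((\<Gamma> + transpose \<Gamma>) *v t)) = t \<bullet> (\<Gamma> *v t)"
    using trans[of t t]
    by (simp add: matrix_vector_mult_add_rdistrib inner_add_right inner_commute del: transpose_matrix_vector)
  have "L \<longlonglongrightarrow> (t \<bullet> (\<Gamma> *v t)) / 2" unfolding L_def by (rule scaled_cumulant_tendsto)
  then have "\<forall>\<^sub>F n in sequentially. dist (L n) ((t \<bullet> (\<Gamma> *v t)) / 2) < \<epsilon>" using \<epsilon> by (rule tendstoD)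
  moreover have "(\<lambda>n. r n *\<^sub>R t) \<longlonglongrightarrow> 0 *\<^sub>R t" by (intro tendsto_intros r_lim)
  then have "\<forall>\<^sub>F n in sequentially. 0 < W n (r n *\<^sub>R t)"
    using eventually_ln_W[of "\<lambda>n. r n *\<^sub>R t"] by (auto elim: eventually_mono)
  ultimately show "\<forall>\<^sub>F n in sequentially.
      exp (1 / a n * ((t \<bullet> ((1 / 2) *\<^sub>R ((\<Gamma> + transpose \<Gamma>) *v t))) / 2 - \<epsilon>))
        \<le> (\<integral>w. exp (1 / a n * (t \<bullet> X n w)) \<partial>word_measure \<xi> A B \<eta> n) \<and>
      (\<integral>w. exp (1 / a n * (t \<bullet> X n w)) \<partial>word_measure \<xi> A B \<eta> n)
        \<le> exp (1 / a n * ((t \<bullet> ((1 / 2) *\<^sub>R ((\<Gamma> + transpose \<Gamma>) *v t))) / 2 + \<epsilon>))"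
    using eventually_W0_pos
  proof eventually_elim
    case (elim n)
    have an: "0 < a n" by (rule a_pos)
    have "(\<integral>w. exp (1 / a n * (t \<bullet> X n w)) \<partial>word_measure \<xi> A B \<eta> n)
        = exp (- (real n * (r n * (t \<bullet> \<beta>)))) * (exp (ln (W n (r n *\<^sub>R t))) / exp (ln (W n 0)))"
      using elim by (simp only: integral_exp_X exp_ln)
    also have "\<dots> = exp (1 / a n * L n)"
      using an by (simp add: L_def flip: exp_diff exp_add)
    finally have int: "(\<integral>w. exp (1 / a n * (t \<bullet> X n w)) \<partial>word_measure \<xi> A B \<eta> n) = exp (1 / a n * L n)" .
    have "(t \<bullet> (\<Gamma> *v t)) / 2 - \<epsilon> \<le> L n" "L n \<le> (t \<bullet> (\<Gamma> *v t)) / 2 + \<epsilon>"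
      using elim(1) by (auto simp: dist_real_def abs_less_iff)
    then show ?case
      unfolding int half exp_le_cancel_iff using an by (intro conjI mult_left_mono) auto
  qed
qed

lemma satisfies_LDP_X:
  "satisfies_LDP (word_measure \<xi> A B \<eta>) X (\<lambda>n. 1 / a n)
     (\<lambda>x. SUP t. ereal (t \<bullet> x - 1 / 2 * (t \<bullet> (\<Gamma> *v t))))"
proof -
  interpret Q: quadratic_cumulants "word_measure \<xi> A B \<eta>" X "\<lambda>n. 1 / a n" "\<lambda>t. (1 / 2) *\<^sub>R ((\<Gamma> + transpose \<Gamma>) *v t)"
    by (rule quadratic_cumulants_word_measure)
  have "Q.cumulant t = 1 / 2 * (t \<bullet> (\<Gamma> *v t))" for t
    using inner_transpose_mult[of t "transpose \<Gamma>" t] unfolding Q.cumulant_def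
    by (simp add: matrix_vector_mult_add_rdistrib inner_add_right inner_commute del: transpose_matrix_vector)
  then have "Q.rate = (\<lambda>x. SUP t. ereal (t \<bullet> x - 1 / 2 * (t \<bullet> (\<Gamma> *v t))))"
    unfolding Q.rate_def[abs_def] by (simp only:)
  then show ?thesis using Q.satisfies_LDP_quadratic by simp
qed

end

end

text \<open>A single word of positive weight excludes \<open>\<xi> = 0\<close> and
  \<open>\<eta> = 0\<close>.\<close>

lemma primitive_representationI:
  assumes rep: "linear_representation \<xi> A B \<eta>" and "primitive_matrix (total_matrix A B)"
  shows "primitive_representation A B \<xi> \<eta>"
proof
  obtain w where w: "0 < word_weight \<xi> A B \<eta> w"
    using rep eventually_happens'[OF sequentially_bot] unfolding linear_representation_def by blast
  show "\<xi> \<noteq> 0" "\<eta> \<noteq> 0" using w by (auto simp: word_weight_def)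
qed (use assms in \<open>simp_all add: linear_representation_def\<close>)

theorem theorem5:
  fixes \<xi> \<eta> :: "real^'m"
    and A :: "'l::finite \<Rightarrow> real^'m^'m"
    and B :: "real^'m^'m"
    and y :: "real^'l \<Rightarrow> real"
    and \<beta> :: "real^'l"
    and \<Gamma> :: "real^'l^'l"
    and a :: "nat \<Rightarrow> real"
  assumes "linear_representation \<xi> A B \<eta>"
    and "primitive_matrix (total_matrix A B)"
    and "y = (\<lambda>t. pf_eigenvalue (tilted_matrix A B t))"
    and "\<beta> = (1 / y 0) *\<^sub>R gradient y 0"
    and "\<Gamma> = hessian (\<lambda>t. ln (y t)) 0"
    and "\<And>n. 0 < a n"
    and "a \<longlonglongrightarrow> 0"
    and "filterlim (\<lambda>n. real n * a n) at_top sequentially"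
  shows "satisfies_LDP
           (word_measure \<xi> A B \<eta>)
           (\<lambda>n w. (1 / sqrt (real n / a n)) *\<^sub>R (symbol_statistics w - real n *\<^sub>R \<beta>))
           (\<lambda>n. 1 / a n)
           (\<lambda>x. SUP t. ereal (t \<bullet> x - 1 / 2 * (t \<bullet> (\<Gamma> *v t))))"
proof -
  interpret primitive_representation A B \<xi> \<eta>
    by (rule primitive_representationI[OF assms(1,2)])
  \<comment> \<open>Logarithmic differentiation identifies \<open>gradient y 0\<close> divided by
    \<open>y 0\<close> with the gradient of \<open>ln y\<close>, the centring used in the scaled
    cumulants.\<close>
  have "\<beta> = gradient (\<lambda>t. ln (pf_eigenvalue (tilted_matrix A B t))) 0"
    unfolding gradient_ln_y assms(4) assms(3) gradient_y ..
  then show ?thesis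
    using satisfies_LDP_X[OF assms(6-8)]
    unfolding X_def[OF assms(6-8), abs_def] assms(5) assms(3) by simp
qed

end
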